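(* Let $m\ge4$ be an integer and put $n=2^m-1$. Let $\theta$ be a primitive element of $\mathbb F_{2^m}$ (of multiplicative order $2^m-1$), let $g_1(x),g_{-1}(x)\in\mathbb F_2[x]$ be the minimal polynomials over $\mathbb F_2$ of $\theta$ and $\theta^{-1}$ respectively, and let $g(x)=g_1(x)g_{-1}(x)$. Let $\mathcal C\subseteq\mathbb F_2^n$ be the cyclic code of length $n$ with generator polynomial $g(x)$, and let $\mathcal O\subseteq\mathbb F_2^n$ be the Euclidean dual of $\mathcal C$. Then $\mathcal O$ is a binary orthogonal array of cardinality $M=2^{2m}$ and strength $$\tau=\begin{cases}2&\text{if } m \text{ is even},\\4&\text{if } m\text{ is odd},\end{cases}$$ and its covering radius satisfies $$R(\mathcal O)\ge\left\lceil\frac{2^m-1-\left\lfloor2^{m/2+1}\right\rfloor}{2}\right\rceil.$$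
   Context: A code $C\subset\mathbb F_2^n$ with $M=|C|$ is a binary orthogonal array of strength $\tau$ if in the $M\times n$ matrix whose rows are the codewords, every $M\times\tau$ submatrix contains every element of $\mathbb F_2^\tau$ as a row exactly $M/2^\tau$ times. For linear $C$ the strength is $\tau=d^\perp-1$, where $d^\perp$ is the minimum distance of the dual code $C^\perp$. The covering radius is $R(C)=\max_{y\in\mathbb F_2^n}\min_{x\in C}d(x,y)$, with $d$ the Hamming distance. The cyclic code of length $n$ with generator polynomial $g$ is the set of coefficient vectors of the polynomials of degree less than $n$ over $\mathbb F_2$ that are multiples of $g$ (modulo $x^n-1$). The Euclidean dual is with respect to the standard inner product on $\mathbb F_2^n$. *)

theory Defs
  imports
    Complex_Main
    "HOL-Library.Z2"
    "HOL-Library.Cardinality"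
    "HOL-Number_Theory.Cong"
    "HOL-Computational_Algebra.Polynomial"
    "Jordan_Normal_Form.Matrix"
begin

text \<open>The binary field is \<^typ>\<open>bit\<close>, and \<open>F\<^sub>2\<^sup>n\<close> is \<^term>\<open>carrier_vec n :: bit vec set\<close>.\<close>

definition has_mult_order :: "'a::monoid_mult \<Rightarrow> nat \<Rightarrow> bool" where
  "has_mult_order x N \<longleftrightarrow> N > 0 \<and> x ^ N = 1 \<and> (\<forall>k. 0 < k \<and> k < N \<longrightarrow> x ^ k \<noteq> 1)"

text \<open>
  Coefficients are embedded along \<^term>\<open>of_bit\<close>, which sends 0 to 0 and 1 to 1; it is the
  inclusion of the prime field when \<^typ>\<open>'a\<close> has characteristic 2.
\<close>

definition eval_at :: "bit poly \<Rightarrow> 'a::field \<Rightarrow> 'a" where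
  "eval_at p x = poly (map_poly of_bit p) x"

definition is_min_poly :: "'a::field \<Rightarrow> bit poly \<Rightarrow> bool" where
  "is_min_poly x p \<longleftrightarrow>
     lead_coeff p = 1 \<and> eval_at p x = 0 \<and>
     (\<forall>q. q \<noteq> 0 \<and> eval_at q x = 0 \<longrightarrow> degree p \<le> degree q)"

definition cyclic_code :: "nat \<Rightarrow> bit poly \<Rightarrow> bit vec set" where
  "cyclic_code n g =
     {vec n (coeff p) | p. degree p < n \<and> (\<exists>h. [p = g * h] (mod (monom 1 n - 1)))}"

definition dual_code :: "nat \<Rightarrow> bit vec set \<Rightarrow> bit vec set" where
  "dual_code n C = {y \<in> carrier_vec n. \<forall>x\<in>C. x \<bullet> y = 0}"

definition hamming_dist :: "bit vec \<Rightarrow> bit vec \<Rightarrow> nat" where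
  "hamming_dist x y = card {i. i < dim_vec x \<and> x $ i \<noteq> y $ i}"

text \<open>Meaningful for codes with at least two words.\<close>

definition min_distance :: "bit vec set \<Rightarrow> nat" where
  "min_distance C = Min {hamming_dist x y | x y. x \<in> C \<and> y \<in> C \<and> x \<noteq> y}"

definition covering_radius :: "nat \<Rightarrow> bit vec set \<Rightarrow> nat" where
  "covering_radius n C =
     Max ((\<lambda>y. Min ((\<lambda>x. hamming_dist x y) ` C)) ` carrier_vec n)"

text \<open>
  The set \<open>T\<close> selects \<open>t\<close> columns of the array whose rows are the codewords; an element of
  \<open>F\<^sub>2\<^sup>t\<close>, indexed by \<open>T\<close>, is given by the values on \<open>T\<close> of a function \<open>w\<close>.
  The bound \<open>t \<le> n\<close> excludes the case in which no such \<open>T\<close> exists.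
\<close>

definition orthogonal_array :: "nat \<Rightarrow> bit vec set \<Rightarrow> nat \<Rightarrow> bool" where
  "orthogonal_array n C t \<longleftrightarrow>
     C \<subseteq> carrier_vec n \<and> t \<le> n \<and>
     (\<forall>T w. T \<subseteq> {..<n} \<and> card T = t \<longrightarrow>
        real (card {x \<in> C. \<forall>i\<in>T. x $ i = w i}) = real (card C) / 2 ^ t)"

end

theory Submission
  imports Defs
begin

text \<open>
  Write \<open>q = 2 ^ m\<close>. By orthogonality of characters a binary linear code is its own double dual, so
  the dual of the cyclic code consists of the words \<open>c(a,b) = (Tr (a \<theta>\<^sup>i + b \<theta>\<^sup>-\<^sup>i))\<^sub>i\<close>. The weights of
  these words are given by Kloosterman sums, and the distance of the all-one vector to the words yields
  the bound on the covering radius once Kloosterman sums are known to be at least \<open>-2 \<surd>q\<close>.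

  That inequality is proved by Manin's argument for the Hasse bound, without the group law. In the
  rational function field in \<open>t\<close> consider the symmetric biquadratic relation between the abscissas
  of \<open>P\<close> and \<open>P + Q\<close> on a twist of the curve attached to the Kloosterman sum, where \<open>Q\<close> has abscissa
  \<open>t\<close>. Starting from the abscissa \<open>t\<^sup>q\<close> of the Frobenius point, Vieta jumping produces a sequence of
  solutions whose heights satisfy \<open>h\<^sub>k + h\<^sub>k\<^sub>+\<^sub>2 = 2 h\<^sub>k\<^sub>+\<^sub>1 + 2\<close>. If \<open>K\<close> is the Kloosterman sum, then
  \<open>h\<^sub>0 = q\<close> and \<open>h\<^sub>1 = q + 1 + K\<close>, so \<open>h\<^sub>k = k\<^sup>2 + K k + q\<close>. As heights are nonnegative, so is this
  polynomial at the natural numbers. Its values are even, whereas \<open>t\<close> has height 1; hence the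
  sequence never meets the degenerate value \<open>t\<close>.

  The dual distance comes from solving \<open>\<Sum>a = \<Sum>1/a = 0\<close> in sets of distinct nonzero elements; three
  elements are essentially \<open>1, \<omega>, \<omega>\<^sup>2\<close> with \<open>\<omega>\<^sup>3 = 1\<close>, which needs \<open>m\<close> even, four are impossible, and
  five exist for odd \<open>m\<close>, again by the bound on Kloosterman sums.
\<close>

section \<open>Vieta jumping for the biquadratic relation\<close>

lemma char2_simps:
  fixes a b :: "'b::comm_ring_1"
  assumes "(2::'b) = 0"
  shows "a + a = 0" "a + (a + b) = b" "- a = a" "a - b = a + b"
proof -
  show *: "a + a = 0" for a :: 'b
    using assms by (metis mult_2 mult_zero_left)
  show "a + (a + b) = b" by (simp add: * flip: add.assoc)
  show **: "- a = a" for a :: 'b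
    using * by (simp add: minus_unique)
  show "a - b = a + b" using **[of b] by (metis diff_conv_add_uminus)
qed

lemma char2_square_add:
  fixes a b :: "'b::comm_ring_1"
  assumes "(2::'b) = 0"
  shows "(a + b)\<^sup>2 = a\<^sup>2 + b\<^sup>2"
  by (simp add: power2_sum assms)

lemma char2_poly: "(2::'b::comm_ring_1) = 0 \<Longrightarrow> (2::'b poly) = 0"
  by (metis numeral_poly pCons_0_0)

section \<open>Comaximal pairs (coprimality as a Bezout identity) and heights of pairs of
  polynomials\<close>

definition comaximal :: "'b::comm_ring_1 \<Rightarrow> 'b \<Rightarrow> bool" where
  "comaximal u v \<longleftrightarrow> (\<exists>a b. a * u + b * v = 1)"

lemma comaximal_commute: "comaximal u v \<longleftrightarrow> comaximal v u"
  unfolding comaximal_def by (metis add.commute)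

lemma comaximal_mult:
  assumes "comaximal u v" "comaximal u w"
  shows "comaximal u (v * w)"
proof -
  obtain a b c d where "a * u + b * v = 1" "c * u + d * w = 1"
    using assms unfolding comaximal_def by blast
  then have "(a * u + b * v) * (c * u + d * w) = 1" by simp
  then have "(a * c * u + a * d * w + b * v * c) * u + (b * d) * (v * w) = 1"
    by (simp add: algebra_simps)
  then show ?thesis unfolding comaximal_def by blast
qed

lemma comaximal_1: "comaximal u 1"
  unfolding comaximal_def by (rule exI[of _ 0], rule exI[of _ 1]) simp

lemma comaximal_power: "comaximal u v \<Longrightarrow> comaximal u (v ^ k)"
  by (induction k) (auto intro: comaximal_mult comaximal_1)

lemma comaximal_power2:
  "comaximal u v \<Longrightarrow> comaximal (u ^ j) (v ^ k)"
  using comaximal_power comaximal_commute by metis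

lemma comaximal_prod:
  "(\<And>i. i \<in> A \<Longrightarrow> comaximal u (f i)) \<Longrightarrow> comaximal u (prod f A)"
  by (induction A rule: infinite_finite_induct) (auto intro: comaximal_mult comaximal_1)

lemma comaximal_dvd_mult:
  assumes "comaximal u v" "v dvd u * w"
  shows "v dvd w"
proof -
  obtain a b where "a * u + b * v = 1" using assms(1) unfolding comaximal_def by blast
  then have "w = a * (u * w) + b * w * v"
    by (metis (no_types, lifting) distrib_right mult.assoc mult.commute mult_1)
  then show ?thesis using assms(2) by (metis dvd_add dvd_mult dvd_triv_right)
qed

lemma comaximal_linear:
  fixes p :: "'b::field poly"
  assumes "poly p a \<noteq> 0"
  shows "comaximal p [:-a, 1:]"
proof -
  have "[:-a, 1:] dvd p - [:poly p a:]"
    by (simp add: poly_eq_0_iff_dvd[symmetric])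
  then obtain k where "p - [:poly p a:] = [:-a, 1:] * k" by (rule dvdE)
  then have k: "p = k * [:-a, 1:] + [:poly p a:]" by (simp add: algebra_simps)
  let ?i = "[:1 / poly p a:]"
  have "p - k * [:-a, 1:] = [:poly p a:]" using k by (metis add_diff_cancel_left')
  then have "?i * (p - k * [:-a, 1:]) = 1" using assms by (simp add: one_pCons)
  then have "?i * p + (- ?i * k) * [:-a, 1:] = 1"
    by (simp only: distrib_left mult.assoc mult_minus_left mult_minus_right diff_conv_add_uminus)
  then show ?thesis unfolding comaximal_def by blast
qed

text \<open>For a comaximal pair, \<open>h\<close> is the height of the fraction
  \<open>u / v\<close>. Stating it through the coefficients at \<open>h\<close> lets leading terms
  be multiplied without knowing which of the two polynomials attains the degree.\<close>

definition top_degree :: "'b::zero poly \<Rightarrow> 'b poly \<Rightarrow> nat \<Rightarrow> bool" where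
  "top_degree u v h \<longleftrightarrow> degree u \<le> h \<and> degree v \<le> h \<and> (coeff u h \<noteq> 0 \<or> coeff v h \<noteq> 0)"

lemma top_degree_max:
  assumes "u \<noteq> 0 \<or> v \<noteq> 0"
  shows "top_degree u v (max (degree u) (degree v))"
proof -
  have *: "coeff u (degree v) \<noteq> 0 \<or> coeff v (degree v) \<noteq> 0"
    if "degree u \<le> degree v" "u \<noteq> 0 \<or> v \<noteq> 0" for u v :: "'a poly"
  proof (cases "v = 0")
    case True
    then have "degree u = 0" "u \<noteq> 0" using that by auto
    then show ?thesis using True leading_coeff_neq_0[of u] by simp
  qed (simp add: leading_coeff_neq_0)
  show ?thesis
  proof (cases "degree u \<le> degree v")
    case True
    then show ?thesis using *[OF True assms] by (simp add: top_degree_def)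
  next
    case False
    then show ?thesis using *[of v u] assms by (simp add: top_degree_def disj_commute)
  qed
qed

lemma coeff_mult_top:
  fixes p r :: "'b::comm_semiring_0 poly"
  assumes "degree p \<le> i" "degree r \<le> j"
  shows "coeff (p * r) (i + j) = coeff p i * coeff r j"
proof (cases "degree p = i \<and> degree r = j")
  case True then show ?thesis using coeff_mult_degree_sum by blast
next
  case False
  then have "degree p < i \<or> degree r < j" using assms by linarith
  then have "coeff p i * coeff r j = 0" by (auto simp: coeff_eq_0)
  moreover have "degree (p * r) < i + j" using False assms degree_mult_le[of p r] by linarith
  ultimately show ?thesis by (simp add: coeff_eq_0)
qed

text \<open>
  In characteristic 2, \<open>biquad t c u\<^sub>0 v\<^sub>0 u\<^sub>1 v\<^sub>1 = 0\<close> says that \<open>x = u\<^sub>0/v\<^sub>0\<close> and \<open>y = u\<^sub>1/v\<^sub>1\<close> satisfy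
  \<open>x\<^sup>2y\<^sup>2 + t\<^sup>2x\<^sup>2 + t\<^sup>2y\<^sup>2 + txy + c = 0\<close>, the relation between the abscissas of \<open>P\<close> and \<open>P + Q\<close>
  on \<open>Y\<^sup>2 + XY = X\<^sup>3 + \<delta>X\<^sup>2 + c\<close>, where \<open>\<delta> = t + c/t\<^sup>2\<close> and \<open>Q = (t, 0)\<close>.
\<close>
definition biquad :: "'b::comm_ring_1 \<Rightarrow> 'b \<Rightarrow> 'b \<Rightarrow> 'b \<Rightarrow> 'b \<Rightarrow> 'b \<Rightarrow> 'b" where
  "biquad t c u\<^sub>0 v\<^sub>0 u\<^sub>1 v\<^sub>1 =
     u\<^sub>0\<^sup>2 * (u\<^sub>1 + t * v\<^sub>1)\<^sup>2 + u\<^sub>0 * v\<^sub>0 * (t * u\<^sub>1 * v\<^sub>1) + v\<^sub>0\<^sup>2 * (t\<^sup>2 * u\<^sub>1\<^sup>2 + c * v\<^sub>1\<^sup>2)"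

text \<open>The three elements combined here are the coefficients of \<open>biquad\<close> as a
  quadratic form in its first pair. Their ideal contains \<open>u ^ 3\<close> and, \<open>c\<close>
  being a unit, \<open>v ^ 3\<close>; cubes of a comaximal pair are again comaximal.\<close>

lemma comaximal_triple:
  fixes u v t c c' :: "'b::idom"
  assumes char2: "(2::'b) = 0" and "comaximal u v" and "c' * c = 1"
  obtains a b d where
    "a * (u + t * v)\<^sup>2 + b * (t * u * v) + d * (t\<^sup>2 * u\<^sup>2 + c * v\<^sup>2) = 1"
proof -
  note [simp] = char2_simps[OF char2]
  let ?A = "(u + t * v)\<^sup>2" and ?B = "t * u * v" and ?C = "t\<^sup>2 * u\<^sup>2 + c * v\<^sup>2"
  have A: "?A = u\<^sup>2 + t\<^sup>2 * v\<^sup>2"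
    by (simp add: char2_square_add[OF char2] power_mult_distrib)
  have u3: "u ^ 3 = u * ?A + t * v * ?B"
    unfolding A by (simp add: power2_eq_square power3_eq_cube algebra_simps)
  have "c * v ^ 3 = t * u * ?B + v * ?C"
    by (simp add: power2_eq_square power3_eq_cube algebra_simps)
  then have v3: "v ^ 3 = c' * t * u * ?B + c' * v * ?C"
    using assms(3) by (metis (no_types, lifting) distrib_left mult.assoc mult_1)
  obtain r s where "r * u ^ 3 + s * v ^ 3 = 1"
    using comaximal_power2[OF assms(2), of 3 3] unfolding comaximal_def by blast
  then have "r * (u * ?A + t * v * ?B) + s * (c' * t * u * ?B + c' * v * ?C) = 1"
    unfolding u3 v3 .
  then have "(r * u) * ?A + (r * t * v + s * c' * t * u) * ?B + (s * c' * v) * ?C = 1"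
    by (simp add: algebra_simps)
  then show ?thesis by (rule that)
qed

text \<open>For a fixed fraction \<open>u\<^sub>1 / v\<^sub>1\<close> the relation is quadratic in
  the other one, and the new pair is its second root. The three equations factor the form
  \<open>A X^2 + B X Y + C Y^2\<close> as
  \<open>(v\<^sub>0 X + u\<^sub>0 Y) (v\<^sub>2 X + u\<^sub>2 Y)\<close>, so comaximality of its
  coefficients passes to the new pair. Hypothesis \<open>ne\<close> keeps the leading coefficient
  nonzero.\<close>

lemma vieta_jump:
  fixes u\<^sub>0 v\<^sub>0 u\<^sub>1 v\<^sub>1 t c c' :: "'b::idom"
  assumes char2: "(2::'b) = 0" and co0: "comaximal u\<^sub>0 v\<^sub>0" and co1: "comaximal u\<^sub>1 v\<^sub>1"
    and c: "c' * c = 1" and rel: "biquad t c u\<^sub>0 v\<^sub>0 u\<^sub>1 v\<^sub>1 = 0" and ne: "u\<^sub>1 \<noteq> t * v\<^sub>1"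
  obtains u\<^sub>2 v\<^sub>2 where
    "v\<^sub>0 * v\<^sub>2 = (u\<^sub>1 + t * v\<^sub>1)\<^sup>2" "u\<^sub>0 * v\<^sub>2 + v\<^sub>0 * u\<^sub>2 = t * u\<^sub>1 * v\<^sub>1"
    "u\<^sub>0 * u\<^sub>2 = t\<^sup>2 * u\<^sub>1\<^sup>2 + c * v\<^sub>1\<^sup>2"
    "comaximal u\<^sub>2 v\<^sub>2" "biquad t c u\<^sub>1 v\<^sub>1 u\<^sub>2 v\<^sub>2 = 0"
proof -
  note c2 [simp] = char2_simps[OF char2]
  let ?A = "(u\<^sub>1 + t * v\<^sub>1)\<^sup>2" and ?B = "t * u\<^sub>1 * v\<^sub>1" and ?C = "t\<^sup>2 * u\<^sub>1\<^sup>2 + c * v\<^sub>1\<^sup>2"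
  have eq: "u\<^sub>0\<^sup>2 * ?A = v\<^sub>0 * (u\<^sub>0 * ?B + v\<^sub>0 * ?C)"
    using rel unfolding biquad_def
    by (metis (no_types, lifting) c2(3) add.assoc add_eq_0_iff distrib_left mult.assoc mult.left_commute power2_eq_square)
  have "?A \<noteq> 0" using ne by (metis c2(3) add_eq_0_iff zero_eq_power2)
  have "comaximal (u\<^sub>0\<^sup>2) v\<^sub>0" using comaximal_power2[OF co0, of 2 1] by simp
  then have "v\<^sub>0 dvd ?A" using eq by (metis comaximal_dvd_mult dvd_triv_left)
  then obtain v2 where v2: "?A = v\<^sub>0 * v2" by (rule dvdE)
  have "v\<^sub>0 \<noteq> 0" using v2 \<open>?A \<noteq> 0\<close> by auto
  have "v\<^sub>0 * (u\<^sub>0\<^sup>2 * v2) = v\<^sub>0 * (u\<^sub>0 * ?B + v\<^sub>0 * ?C)"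
    using eq v2 by (simp add: mult.left_commute)
  then have "u\<^sub>0\<^sup>2 * v2 = u\<^sub>0 * ?B + v\<^sub>0 * ?C" using \<open>v\<^sub>0 \<noteq> 0\<close> by simp
  moreover have cancel: "x + y = z" if "x = y + z" for x y z :: 'b
    using that by (simp add: add.commute)
  ultimately have "u\<^sub>0\<^sup>2 * v2 + u\<^sub>0 * ?B = v\<^sub>0 * ?C" by blast
  then have C: "u\<^sub>0 * (u\<^sub>0 * v2 + ?B) = v\<^sub>0 * ?C"
    by (simp only: distrib_left power2_eq_square mult.assoc)
  then have "v\<^sub>0 dvd u\<^sub>0 * v2 + ?B" using co0 by (metis comaximal_dvd_mult dvd_triv_left)
  then obtain u2 where u2: "u\<^sub>0 * v2 + ?B = v\<^sub>0 * u2" by (rule dvdE)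
  then have B: "?B = u\<^sub>0 * v2 + v\<^sub>0 * u2" by (metis c2(2))
  have "v\<^sub>0 * (u\<^sub>0 * u2) = v\<^sub>0 * ?C" using C u2 by (simp add: mult.left_commute)
  then have C': "?C = u\<^sub>0 * u2" using \<open>v\<^sub>0 \<noteq> 0\<close> by simp
  obtain a b d where "a * ?A + b * ?B + d * ?C = 1"
    using comaximal_triple[OF char2 co1 c] by blast
  then have "a * (v\<^sub>0 * v2) + b * (u\<^sub>0 * v2 + v\<^sub>0 * u2) + d * (u\<^sub>0 * u2) = 1"
    unfolding v2 B C' .
  then have "(b * v\<^sub>0 + d * u\<^sub>0) * u2 + (a * v\<^sub>0 + b * u\<^sub>0) * v2 = 1"
    by (simp add: algebra_simps)
  then have "comaximal u2 v2" unfolding comaximal_def by blast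
  \<comment> \<open>The relation is symmetric in the two pairs, so this is the form with
    coefficients \<open>?A\<close>, \<open>?B\<close>, \<open>?C\<close> evaluated at the new pair,
    one of its zeros.\<close>
  moreover have "biquad t c u\<^sub>1 v\<^sub>1 u2 v2 = 0"
  proof -
    have "biquad t c u\<^sub>1 v\<^sub>1 u2 v2 = u2\<^sup>2 * ?A + u2 * v2 * ?B + v2\<^sup>2 * ?C"
      unfolding biquad_def char2_square_add[OF char2]
      by (simp add: power2_eq_square algebra_simps)
    also have "\<dots> = 0" unfolding v2 B C' by (simp add: power2_eq_square algebra_simps)
    finally show ?thesis .
  qed
  ultimately show ?thesis using that[of v2 u2] v2 B C' by simp
qed

text \<open>The largest degree among the coefficients of the quadratic form is computed twice. By
  Gauss's lemma for the degree it is the sum of the heights of the two linear factors; read off from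
  \<open>u\<^sub>1\<close> and \<open>v\<^sub>1\<close> it is
  \<open>2 * h\<^sub>1 + 2\<close>.\<close>

lemma top_degree_jump:
  fixes u\<^sub>0 v\<^sub>0 u\<^sub>1 v\<^sub>1 u\<^sub>2 v\<^sub>2 :: "'b::field poly"
  assumes "v\<^sub>0 * v\<^sub>2 = (u\<^sub>1 + [:0, 1:] * v\<^sub>1)\<^sup>2" "u\<^sub>0 * v\<^sub>2 + v\<^sub>0 * u\<^sub>2 = [:0, 1:] * u\<^sub>1 * v\<^sub>1"
    "u\<^sub>0 * u\<^sub>2 = [:0, 1:]\<^sup>2 * u\<^sub>1\<^sup>2 + [:c:] * v\<^sub>1\<^sup>2"
    and "top_degree u\<^sub>0 v\<^sub>0 h\<^sub>0" "top_degree u\<^sub>1 v\<^sub>1 h\<^sub>1" "comaximal u\<^sub>2 v\<^sub>2"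
  obtains h\<^sub>2 where "top_degree u\<^sub>2 v\<^sub>2 h\<^sub>2" "h\<^sub>0 + h\<^sub>2 = 2 * h\<^sub>1 + 2"
proof -
  define h2 where "h2 = max (degree u\<^sub>2) (degree v\<^sub>2)"
  have "u\<^sub>2 \<noteq> 0 \<or> v\<^sub>2 \<noteq> 0" using assms(6) unfolding comaximal_def by auto
  then have td2: "top_degree u\<^sub>2 v\<^sub>2 h2" unfolding h2_def by (rule top_degree_max)
  have d: "degree (p * r) \<le> i + j" if "degree p \<le> i" "degree r \<le> j" for p r :: "'b poly" and i j
    using that degree_mult_le[of p r] by linarith
  have d0: "degree u\<^sub>0 \<le> h\<^sub>0" "degree v\<^sub>0 \<le> h\<^sub>0" and d1: "degree u\<^sub>1 \<le> h\<^sub>1" "degree v\<^sub>1 \<le> h\<^sub>1"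
    and d2: "degree u\<^sub>2 \<le> h2" "degree v\<^sub>2 \<le> h2"
    using assms(4,5) td2 unfolding top_degree_def by auto
  let ?A = "(u\<^sub>1 + [:0, 1:] * v\<^sub>1)\<^sup>2" and ?B = "[:0, 1:] * u\<^sub>1 * v\<^sub>1"
    and ?C = "[:0, 1:]\<^sup>2 * u\<^sub>1\<^sup>2 + [:c:] * v\<^sub>1\<^sup>2"
  let ?top = "\<lambda>N. degree ?A \<le> N \<and> degree ?B \<le> N \<and> degree ?C \<le> N \<and>
    (coeff ?A N \<noteq> 0 \<or> coeff ?B N \<noteq> 0 \<or> coeff ?C N \<noteq> 0)"
  have uniq: "N = N'" if "?top N" "?top N'" for N N'
  proof -
    have *: False if "degree p\<^sub>1 \<le> i" "degree p\<^sub>2 \<le> i" "degree p\<^sub>3 \<le> i" "i < j"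
      "coeff p\<^sub>1 j \<noteq> 0 \<or> coeff p\<^sub>2 j \<noteq> 0 \<or> coeff p\<^sub>3 j \<noteq> 0" for p\<^sub>1 p\<^sub>2 p\<^sub>3 :: "'b poly" and i j
      using that by (auto simp: coeff_eq_0)
    show ?thesis
    proof (cases N N' rule: linorder_cases)
      case less then show ?thesis using that * by blast
    next
      case greater then show ?thesis using that * by blast
    qed
  qed
  have "?top (h\<^sub>0 + h2)"
  proof (intro conjI)
    show "degree ?A \<le> h\<^sub>0 + h2" using d[OF d0(2) d2(2)] assms(1) by simp
    show "degree ?B \<le> h\<^sub>0 + h2"
      using degree_add_le[OF d[OF d0(1) d2(2)] d[OF d0(2) d2(1)]] assms(2) by simp
    show "degree ?C \<le> h\<^sub>0 + h2" using d[OF d0(1) d2(1)] assms(3) by simp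
    have "coeff ?A (h\<^sub>0 + h2) = coeff v\<^sub>0 h\<^sub>0 * coeff v\<^sub>2 h2"
      unfolding assms(1)[symmetric] by (rule coeff_mult_top) (use d0 d2 in auto)
    moreover have "coeff ?B (h\<^sub>0 + h2) = coeff u\<^sub>0 h\<^sub>0 * coeff v\<^sub>2 h2 + coeff v\<^sub>0 h\<^sub>0 * coeff u\<^sub>2 h2"
      unfolding assms(2)[symmetric] by (simp add: coeff_mult_top d0 d2)
    moreover have "coeff ?C (h\<^sub>0 + h2) = coeff u\<^sub>0 h\<^sub>0 * coeff u\<^sub>2 h2"
      unfolding assms(3)[symmetric] by (rule coeff_mult_top) (use d0 d2 in auto)
    ultimately show "coeff ?A (h\<^sub>0 + h2) \<noteq> 0 \<or> coeff ?B (h\<^sub>0 + h2) \<noteq> 0 \<or> coeff ?C (h\<^sub>0 + h2) \<noteq> 0"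
      using assms(4) td2 unfolding top_degree_def by auto
  qed
  moreover have "?top (2 * h\<^sub>1 + 2)"
  proof (intro conjI)
    have X: "degree [:0, 1::'b:] \<le> 1" by simp
    have a: "degree (u\<^sub>1 + [:0, 1:] * v\<^sub>1) \<le> h\<^sub>1 + 1"
      using degree_add_le[of u\<^sub>1 "h\<^sub>1 + 1" "[:0, 1:] * v\<^sub>1"] d[OF X d1(2)] d1 by (simp add: add.commute)
    have e: "2 * h\<^sub>1 + 2 = (h\<^sub>1 + 1) + (h\<^sub>1 + 1)" by simp
    show "degree ?A \<le> 2 * h\<^sub>1 + 2" unfolding e power2_eq_square by (rule d[OF a a])
    have b: "degree ([:0, 1:] * u\<^sub>1) \<le> h\<^sub>1 + 1" using d[OF X d1(1)] by (simp add: add.commute)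
    show "degree ?B \<le> 2 * h\<^sub>1 + 2" unfolding e using d[OF b d1(2)] by linarith
    have C: "?C = ([:0, 1:] * u\<^sub>1) * ([:0, 1:] * u\<^sub>1) + Polynomial.smult c (v\<^sub>1 * v\<^sub>1)"
      by (simp add: power2_eq_square algebra_simps)
    have v: "degree (Polynomial.smult c (v\<^sub>1 * v\<^sub>1)) \<le> h\<^sub>1 + h\<^sub>1"
      using degree_smult_le[of c "v\<^sub>1 * v\<^sub>1"] d[OF d1(2) d1(2)] by linarith
    show "degree ?C \<le> 2 * h\<^sub>1 + 2" unfolding e C
      by (rule degree_add_le[OF d[OF b b]]) (use v in linarith)
    \<comment> \<open>Only \<open>t^2 v^2\<close> in \<open>?A\<close> and \<open>t^2 u^2\<close> in
      \<open>?C\<close> reach this degree there, and their leading coefficients cannot both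
      vanish.\<close>
    have "coeff ?A (2 * h\<^sub>1 + 2) = (coeff v\<^sub>1 h\<^sub>1)\<^sup>2"
      unfolding e power2_eq_square coeff_mult_top[OF a a] using d1 by (simp add: coeff_eq_0)
    moreover have "coeff ?C (2 * h\<^sub>1 + 2) = (coeff u\<^sub>1 h\<^sub>1)\<^sup>2"
    proof -
      have "coeff (Polynomial.smult c (v\<^sub>1 * v\<^sub>1)) (2 * h\<^sub>1 + 2) = 0" by (rule coeff_eq_0) (use v in linarith)
      then show ?thesis unfolding C coeff_add unfolding e coeff_mult_top[OF b b]
        by (simp add: power2_eq_square)
    qed
    ultimately show "coeff ?A (2 * h\<^sub>1 + 2) \<noteq> 0 \<or> coeff ?B (2 * h\<^sub>1 + 2) \<noteq> 0 \<or> coeff ?C (2 * h\<^sub>1 + 2) \<noteq> 0"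
      using assms(5) unfolding top_degree_def by auto
  qed
  ultimately have "h\<^sub>0 + h2 = 2 * h\<^sub>1 + 2" by (rule uniq)
  with td2 show ?thesis by (rule that)
qed

lemma vieta_chain:
  fixes u\<^sub>0 v\<^sub>0 u\<^sub>1 v\<^sub>1 :: "'b::field poly" and K :: int
  assumes char2: "(2::'b) = 0" and "c \<noteq> 0" and "odd K" and "even q"
    and "comaximal u\<^sub>0 v\<^sub>0" "comaximal u\<^sub>1 v\<^sub>1" "biquad [:0, 1:] [:c:] u\<^sub>0 v\<^sub>0 u\<^sub>1 v\<^sub>1 = 0"
    and "top_degree u\<^sub>0 v\<^sub>0 q" "top_degree u\<^sub>1 v\<^sub>1 h\<^sub>1" "int h\<^sub>1 = q + 1 + K"
  shows "(int n)\<^sup>2 + K * int n + int q \<ge> 0"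
proof -
  \<comment> \<open>The solution of the height recursion with initial values \<open>q\<close> and
    \<open>h\<^sub>1\<close>: its second difference is 2.\<close>
  define f where "f k = (int k)\<^sup>2 + K * int k + int q" for k
  have ev: "even (f k)" for k using assms(3,4) unfolding f_def by auto
  have inv: "[:1 / c:] * [:c:] = 1" using assms(2) by (simp add: one_pCons)
  have "\<exists>u v u' v' h h'. comaximal u v \<and> comaximal u' v' \<and> biquad [:0, 1:] [:c:] u v u' v' = 0
    \<and> top_degree u v h \<and> top_degree u' v' h' \<and> int h = f n \<and> int h' = f (Suc n)"
  proof (induction n)
    case 0
    have "int q = f 0" "int h\<^sub>1 = f (Suc 0)" using assms(10) by (simp_all add: f_def)
    then show ?case using assms(5-9) by blast
  next
    case (Suc n)
    then obtain u v u' v' h h' where co: "comaximal u v" "comaximal u' v'"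
      and rel: "biquad [:0, 1:] [:c:] u v u' v' = 0"
      and td: "top_degree u v h" "top_degree u' v' h'" and h: "int h = f n" "int h' = f (Suc n)"
      by blast
    have ne: "u' \<noteq> [:0, 1:] * v'"
    proof
      assume u': "u' = [:0, 1:] * v'"
      \<comment> \<open>Comaximality makes \<open>v'\<close> constant, so the pair would have the
        odd height 1.\<close>
      obtain a b where "a * u' + b * v' = 1" using co(2) unfolding comaximal_def by blast
      then have "v' * (a * [:0, 1:] + b) = 1" unfolding u' by (simp add: algebra_simps)
      then have "v' dvd 1" by (metis dvd_triv_left)
      then obtain k where k: "v' = [:k:]" "k \<noteq> 0"
        by (metis is_unit_polyE dvd_0_left_iff zero_neq_one pCons_0_0)
      have "top_degree u' v' h'" by fact
      then have "h' = 1" unfolding u' k top_degree_def using k(2)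
        by (cases h') (auto simp: coeff_pCons split: nat.splits)
      then show False using ev[of "Suc n"] h by simp
    qed
    obtain u2 v2 where n: "v * v2 = (u' + [:0, 1:] * v')\<^sup>2" "u * v2 + v * u2 = [:0, 1:] * u' * v'"
      "u * u2 = [:0, 1:]\<^sup>2 * u'\<^sup>2 + [:c:] * v'\<^sup>2" "comaximal u2 v2"
      "biquad [:0, 1:] [:c:] u' v' u2 v2 = 0"
      by (rule vieta_jump[OF char2_poly[OF char2] co inv rel ne])
    obtain h2 where h2: "top_degree u2 v2 h2" "h + h2 = 2 * h' + 2"
      by (rule top_degree_jump[OF n(1-3) td n(4)])
    have "int h2 = 2 * f (Suc n) + 2 - f n" using h2(2) h by linarith
    also have "\<dots> = f (Suc (Suc n))" unfolding f_def by (simp add: power2_eq_square algebra_simps)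
    finally show ?case using co n td h h2 by blast
  qed
  then show ?thesis unfolding f_def by (metis of_nat_0_le_iff)
qed

section \<open>Kloosterman sums\<close>

lemma char2_pow2_add:
  fixes a b :: "'b::comm_ring_1"
  assumes "(2::'b) = 0"
  shows "(a + b) ^ 2 ^ i = a ^ 2 ^ i + b ^ 2 ^ i"
  by (induction i) (simp_all add: power_mult char2_square_add[OF assms] power_Suc2 del: power_Suc)

lemma char2_square_sum:
  fixes f :: "'c \<Rightarrow> 'b::comm_ring_1"
  assumes "(2::'b) = 0"
  shows "(\<Sum>i\<in>A. f i)\<^sup>2 = (\<Sum>i\<in>A. (f i)\<^sup>2)"
  by (induction A rule: infinite_finite_induct) (simp_all add: char2_square_add[OF assms])

text \<open>In the applications \<open>f (Suc i)\<close> is the square of \<open>f i\<close> up to a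
  fixed factor, so this evaluates Artin-Schreier expressions \<open>z^2 + z\<close> at trace-like
  sums.\<close>

lemma char2_telescope:
  fixes f :: "nat \<Rightarrow> 'b::comm_ring_1"
  assumes "(2::'b) = 0"
  shows "(\<Sum>i<k. f (Suc i)) + (\<Sum>i<k. f i) = f k + f 0"
  by (induction k) (simp_all add: char2_simps[OF assms] add_ac)

lemma prod_linear_dvd:
  fixes p :: "'b::field poly"
  assumes "finite A" "\<And>a. a \<in> A \<Longrightarrow> poly p a = 0"
  shows "(\<Prod>a\<in>A. [:-a, 1:]) dvd p"
  using assms
proof (induction A rule: finite_induct)
  case (insert a A)
  then obtain k where k: "p = (\<Prod>a\<in>A. [:-a, 1:]) * k" by (meson dvdE insertCI)
  have "poly (\<Prod>a\<in>A. [:-a, 1:]) a \<noteq> 0"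
    using insert.hyps by (simp add: poly_prod)
  moreover have "poly p a = 0" using insert.prems by simp
  ultimately have "poly k a = 0" unfolding k by simp
  then have "[:-a, 1:] dvd k" by (simp add: poly_eq_0_iff_dvd)
  then show ?case unfolding k unfolding prod.insert[OF insert.hyps(1,2)] by (subst mult.commute) (rule mult_dvd_mono[OF dvd_refl])
qed simp

section \<open>The field with \<open>2 ^ m\<close> elements and its absolute trace\<close>

locale binary_field =
  fixes m n :: nat and \<theta> :: "'a::{field,finite}"
  assumes m_ge: "m \<ge> 4" and n_eq: "n = 2 ^ m - 1"
    and card_UNIV: "CARD('a) = 2 ^ m" and order_theta: "has_mult_order \<theta> n"
begin

lemma char2: "(2::'a) = 0"
proof -
  \<comment> \<open>Translation by 1 permutes the field, so adding 1 once for each element gives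
    0.\<close>
  have "(\<Sum>x\<in>UNIV. x + 1) = (\<Sum>x\<in>UNIV. x :: 'a)"
    by (rule sum.reindex_bij_witness[of _ "\<lambda>x. x - 1" "\<lambda>x. x + 1"]) auto
  then have "of_nat CARD('a) = (0::'a)" by (simp add: sum.distrib)
  then show ?thesis unfolding card_UNIV by simp
qed

lemmas c2 = char2_simps[OF char2]

lemma char2_poly_ring: "(2::'a poly) = 0"
  by (rule char2_poly[OF char2])

lemma Suc_n: "Suc n = 2 ^ m"
  by (simp add: n_eq)

lemma n_pos: "n \<ge> 15"
proof -
  have "(2::nat) ^ 4 \<le> 2 ^ m" by (rule power_increasing) (use m_ge in auto)
  then show ?thesis using n_eq by simp
qed

lemma odd_n: "odd n"
proof -
  have "even (Suc n)" unfolding Suc_n using m_ge by simp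
  then show ?thesis by simp
qed

lemma theta_nz: "\<theta> \<noteq> 0"
  using order_theta n_pos by (auto simp: has_mult_order_def power_0_left)

lemma theta_pow_n: "\<theta> ^ n = 1"
  using order_theta by (simp add: has_mult_order_def)

lemma inj_theta: "inj_on (\<lambda>i. \<theta> ^ i) {..<n}"
proof (rule linorder_inj_onI)
  fix i j assume ij: "i < j" "i \<in> {..<n}" "j \<in> {..<n}"
  have "\<theta> ^ (j - i) \<noteq> 1" using order_theta ij unfolding has_mult_order_def by auto
  moreover have "\<theta> ^ j = \<theta> ^ i * \<theta> ^ (j - i)" using ij by (simp flip: power_add)
  ultimately show "\<theta> ^ i \<noteq> \<theta> ^ j" using theta_nz by auto
qed auto

lemma card_nz: "card (UNIV - {0::'a}) = n"
  using card_UNIV by (simp add: card_Diff_singleton n_eq)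

lemma bij_theta: "bij_betw (\<lambda>i. \<theta> ^ i) {..<n} (UNIV - {0})"
  unfolding bij_betw_def
proof (intro conjI inj_theta card_subset_eq)
  show "card ((\<lambda>i. \<theta> ^ i) ` {..<n}) = card (UNIV - {0::'a})"
    by (simp add: card_image inj_theta card_nz)
qed (auto simp: theta_nz)

lemma theta_power_cases:
  assumes "(x::'a) \<noteq> 0"
  obtains i where "i < n" "x = \<theta> ^ i"
proof -
  have "x \<in> (\<lambda>i. \<theta> ^ i) ` {..<n}" using bij_betw_imp_surj_on[OF bij_theta] assms by simp
  then show ?thesis using that by auto
qed

lemma pow_n: assumes "(x::'a) \<noteq> 0" shows "x ^ n = 1"
proof -
  obtain i where "x = \<theta> ^ i" using theta_power_cases[OF assms] .
  then show ?thesis by (metis mult.commute power_mult power_one theta_pow_n)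
qed

lemma pow_q: "(x::'a) ^ 2 ^ m = x"
  by (cases "x = 0") (simp_all add: pow_n flip: Suc_n)

definition tr :: "'a \<Rightarrow> 'a" where
  "tr x = (\<Sum>i<m. x ^ 2 ^ i)"

lemma tr_add: "tr (x + y) = tr x + tr y"
  by (simp add: tr_def char2_pow2_add[OF char2] sum.distrib)

lemma tr_0 [simp]: "tr 0 = 0"
  by (simp add: tr_def power_0_left)

lemma tr_square: "tr (x\<^sup>2) = tr x"
proof -
  have "tr (x\<^sup>2) + tr x = (\<Sum>i<m. x ^ 2 ^ Suc i) + (\<Sum>i<m. x ^ 2 ^ i)"
    by (simp add: tr_def flip: power_mult)
  also have "\<dots> = x ^ 2 ^ m + x ^ 2 ^ 0" by (rule char2_telescope[OF char2])
  also have "\<dots> = 0" by (simp add: pow_q c2)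
  finally show ?thesis by (metis add_eq_0_iff c2(3))
qed

lemma square_tr: "(tr x)\<^sup>2 = tr x"
proof -
  have "(tr x)\<^sup>2 = tr (x\<^sup>2)"
    unfolding tr_def char2_square_sum[OF char2] by (simp add: mult.commute flip: power_mult)
  then show ?thesis by (simp add: tr_square)
qed

lemma tr_01: "tr x = 0 \<or> tr x = 1"
proof -
  have "tr x * (tr x - 1) = 0" using square_tr[of x] by (simp add: power2_eq_square right_diff_distrib)
  then show ?thesis by simp
qed

text \<open>The trace is a nonzero polynomial of degree at most \<open>2 ^ (m - 1)\<close>, too
  small for it to vanish on the whole field.\<close>

lemma tr_onto: "\<exists>x. tr x = 1"
proof (rule ccontr)
  assume "\<not> ?thesis"
  then have 0: "tr x = 0" for x using tr_01 by blast
  define p :: "'a poly" where "p = (\<Sum>i<m. monom 1 (2 ^ i))"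
  have "poly p x = tr x" for x by (simp add: p_def tr_def poly_sum poly_monom)
  then have "{x. poly p x = 0} = UNIV" using 0 by auto
  moreover have "coeff p 1 = 1"
  proof -
    have "coeff p 1 = (\<Sum>i<m. if i = 0 then 1 else 0)"
      unfolding p_def coeff_sum by (rule sum.cong) auto
    then show ?thesis using m_ge by simp
  qed
  then have "p \<noteq> 0" by auto
  moreover have "degree p \<le> 2 ^ (m - 1)"
    unfolding p_def
    by (rule degree_sum_le) (auto intro!: order.trans[OF degree_monom_le] power_increasing)
  ultimately have "card (UNIV :: 'a set) \<le> 2 ^ (m - 1)"
    using card_poly_roots_bound[of p] by (metis order.trans)
  moreover have "(2::nat) ^ (m - 1) < 2 ^ m" by (rule power_strict_increasing) (use m_ge in auto)
  ultimately show False unfolding card_UNIV by linarith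
qed

lemma half: "(2::nat) ^ m = 2 ^ (m - 1) + 2 ^ (m - 1)"
  using m_ge by (cases m) simp_all

text \<open>For \<open>e \<noteq> 0\<close> the Kloosterman sum of \<open>(-1)^tr (x + e/x)\<close> over \<open>x \<noteq> 0\<close> is \<open>n - 2 * kloos e\<close>.\<close>
definition kloos :: "'a \<Rightarrow> nat" where
  "kloos e = card {x. x \<noteq> 0 \<and> tr (x + e / x) = 1}"

section \<open>The rational function attached to a Kloosterman sum\<close>

context
  fixes e :: 'a
  assumes e_nz: "e \<noteq> 0"
begin

text \<open>This is \<open>t^(2^(m-1)) * (1 + T)\<close> for the formal trace \<open>T\<close> of
  \<open>t + e/t\<close>. The square of \<open>numer / denom\<close>, divided by \<open>t\<close>,
  is the second abscissa of the Vieta sequence, following \<open>t^q\<close>.\<close>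

definition numer :: "'a poly" where
  "numer = monom 1 (2 ^ m) + monom 1 (2 ^ (m - 1)) + (\<Sum>i<m - 1. monom 1 (2 ^ (m - 1) + 2 ^ i))
    + (\<Sum>i<m. monom (e ^ 2 ^ i) (2 ^ (m - 1) - 2 ^ i))"

definition denom :: "'a poly" where
  "denom = monom 1 n + 1"

text \<open>With \<open>q = 2 ^ m\<close>, telescoping gives
  \<open>T^2 + T = t^q + t + e/t^q + e/t\<close> for the formal trace \<open>T\<close> of
  \<open>t + e/t\<close>; the claim is this identity times \<open>t^q\<close>.\<close>

lemma numer_eq:
  "numer\<^sup>2 + monom 1 (2 ^ (m - 1)) * numer = (monom 1 (2 ^ m + 1) + [:e:]) * denom"
proof -
  note [simp] = char2_simps[OF char2_poly_ring]
  let ?h = "(2::nat) ^ (m - 1)"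
  let ?T = "\<Sum>i<m - 1. monom (1::'a) (?h + 2 ^ i)" and ?U = "\<Sum>i<m. monom (e ^ 2 ^ i) (?h - 2 ^ i)"
  have sq: "(monom a k)\<^sup>2 = monom (a\<^sup>2) (k + k)" for a :: 'a and k
    by (simp add: power2_eq_square mult_monom)
  have T: "?T\<^sup>2 + monom 1 ?h * ?T = monom 1 (2 ^ m + ?h) + monom 1 (2 ^ m + 1)"
  proof -
    have "?T\<^sup>2 = (\<Sum>i<m - 1. monom 1 (2 ^ m + 2 ^ Suc i))"
      unfolding char2_square_sum[OF char2_poly_ring] sq
    proof (rule sum.cong[OF refl])
      show "monom (1\<^sup>2) (?h + 2 ^ i + (?h + 2 ^ i)) = monom (1::'a) (2 ^ m + 2 ^ Suc i)" for i
        unfolding half by (simp add: add_ac mult_2)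
    qed
    moreover have "monom 1 ?h * ?T = (\<Sum>i<m - 1. monom 1 (2 ^ m + 2 ^ i))"
      by (simp add: sum_distrib_left mult_monom half ac_simps)
    ultimately show ?thesis
      using char2_telescope[OF char2_poly_ring, of "\<lambda>i. monom (1::'a) (2 ^ m + 2 ^ i)" "m - 1"] by simp
  qed
  have U: "?U\<^sup>2 + monom 1 ?h * ?U = [:e:] + monom e n"
  proof -
    have le: "(2::nat) ^ i \<le> ?h" if "i < m" for i by (rule power_increasing) (use that in auto)
    have "?U\<^sup>2 = (\<Sum>i<m. monom (e ^ 2 ^ Suc i) (2 ^ m - 2 ^ Suc i))"
      unfolding char2_square_sum[OF char2_poly_ring] sq
    proof (rule sum.cong[OF refl])
      fix i assume "i \<in> {..<m}"
      have "?h - 2 ^ i + (?h - 2 ^ i) = 2 ^ m - 2 ^ Suc i" using le[of i] half by simp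
      then show "monom ((e ^ 2 ^ i)\<^sup>2) (?h - 2 ^ i + (?h - 2 ^ i)) = monom (e ^ 2 ^ Suc i) (2 ^ m - 2 ^ Suc i)"
        by (simp add: mult.commute flip: power_mult)
    qed
    moreover have "monom 1 ?h * ?U = (\<Sum>i<m. monom (e ^ 2 ^ i) (2 ^ m - 2 ^ i))"
      unfolding sum_distrib_left
    proof (rule sum.cong[OF refl])
      fix i assume "i \<in> {..<m}"
      then have "?h + (?h - 2 ^ i) = 2 ^ m - 2 ^ i" using le[of i] half by simp
      then show "monom 1 ?h * monom (e ^ 2 ^ i) (?h - 2 ^ i) = monom (e ^ 2 ^ i) (2 ^ m - 2 ^ i)"
        by (simp add: mult_monom)
    qed
    ultimately show ?thesis
      using char2_telescope[OF char2_poly_ring, of "\<lambda>i. monom (e ^ 2 ^ i) (2 ^ m - 2 ^ i)" m]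
      by (simp add: pow_q n_eq monom_0)
  qed
  have "numer\<^sup>2 + monom 1 ?h * numer
      = (monom 1 (2 ^ m))\<^sup>2 + (monom 1 ?h)\<^sup>2 + monom 1 ?h * monom 1 (2 ^ m) + monom 1 ?h * monom 1 ?h
        + (?T\<^sup>2 + monom 1 ?h * ?T) + (?U\<^sup>2 + monom 1 ?h * ?U)"
    unfolding numer_def by (simp only: char2_square_add[OF char2_poly_ring] distrib_left add_ac)
  also have "\<dots> = monom 1 (2 ^ m + 2 ^ m) + monom 1 (2 ^ m + 1) + [:e:] + monom e n"
    unfolding T U sq mult_monom by (simp add: ac_simps)
  also have "\<dots> = (monom 1 (2 ^ m + 1) + [:e:]) * denom"
    unfolding denom_def
    by (simp add: algebra_simps mult_monom smult_monom flip: monom_0 Suc_n)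
  finally show ?thesis .
qed

lemma numer_degree: "degree numer = 2 ^ m" "lead_coeff numer = 1"
proof -
  define R where "R = monom 1 (2 ^ (m - 1)) + (\<Sum>i<m - 1. monom 1 (2 ^ (m - 1) + 2 ^ i))
    + (\<Sum>i<m. monom (e ^ 2 ^ i) (2 ^ (m - 1) - 2 ^ i))"
  have lt: "(2::nat) ^ i < 2 ^ (m - 1)" if "i < m - 1" for i
    by (rule power_strict_increasing) (use that in auto)
  have "degree R < 2 ^ m" unfolding R_def
  proof (intro degree_add_less degree_sum_less)
    show "degree (monom (1::'a) (2 ^ (m - 1))) < 2 ^ m" using half by (simp add: degree_monom_eq)
    show "degree (monom (1::'a) (2 ^ (m - 1) + 2 ^ i)) < 2 ^ m" if "i \<in> {..<m - 1}" for i
      using half lt[of i] that by (simp add: degree_monom_eq)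
    show "degree (monom (e ^ 2 ^ i) (2 ^ (m - 1) - 2 ^ i)) < 2 ^ m" if "i \<in> {..<m}" for i
    proof (rule le_less_trans[OF degree_monom_le])
      show "(2::nat) ^ (m - 1) - 2 ^ i < 2 ^ m" using half zero_less_power[of "2::nat" "m - 1"] by linarith
    qed
  qed auto
  moreover have "numer = monom 1 (2 ^ m) + R" unfolding numer_def R_def by (simp only: add.assoc)
  ultimately have "degree numer = 2 ^ m \<and> lead_coeff numer = 1"
    by (simp add: degree_add_eq_left lead_coeff_add_le degree_monom_eq coeff_eq_0)
  then show "degree numer = 2 ^ m" "lead_coeff numer = 1" by auto
qed

lemma poly_numer:
  assumes "a \<noteq> 0"
  shows "poly numer a = a ^ 2 ^ (m - 1) * (1 + tr (a + e / a))"
proof -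
  let ?h = "(2::nat) ^ (m - 1)"
  have le: "(2::nat) ^ i \<le> ?h" if "i < m" for i by (rule power_increasing) (use that in auto)
  have tr_a: "tr a = (\<Sum>i<m - 1. a ^ 2 ^ i) + a ^ ?h"
    unfolding tr_def using m_ge by (cases m) simp_all
  have tr_e: "a ^ ?h * tr (e / a) = (\<Sum>i<m. e ^ 2 ^ i * a ^ (?h - 2 ^ i))"
    unfolding tr_def sum_distrib_left
    by (rule sum.cong) (use le assms in \<open>auto simp: power_divide power_diff\<close>)
  have "poly numer a = a ^ 2 ^ m + a ^ ?h + a ^ ?h * (\<Sum>i<m - 1. a ^ 2 ^ i) + a ^ ?h * tr (e / a)"
    unfolding numer_def tr_e by (simp add: poly_sum poly_monom power_add sum_distrib_left)
  also have "(\<Sum>i<m - 1. a ^ 2 ^ i) = tr a + a ^ ?h" unfolding tr_a by (simp add: c2 add_ac)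
  also have "a ^ 2 ^ m + a ^ ?h + a ^ ?h * (tr a + a ^ ?h) + a ^ ?h * tr (e / a)
      = a ^ ?h * (1 + tr (a + e / a))"
    by (simp add: tr_add distrib_left half power_add c2 add_ac)
  finally show ?thesis .
qed

lemma poly_numer_0: "poly numer 0 \<noteq> 0"
proof -
  have "poly numer 0 = (\<Sum>i<m. e ^ 2 ^ i * 0 ^ (2 ^ (m - 1) - 2 ^ i))"
    unfolding numer_def by (simp add: poly_sum poly_monom power_0_left)
  \<comment> \<open>Exponent 0 occurs only for \<open>i = m - 1\<close>.\<close>
  also have "\<dots> = (\<Sum>i<m. if i = m - 1 then e ^ 2 ^ i else 0)"
  proof (rule sum.cong[OF refl])
    fix i assume "i \<in> {..<m}"
    then have "i = m - 1 \<or> (2::nat) ^ i < 2 ^ (m - 1)"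
      by (metis Suc_pred' less_Suc_eq lessThan_iff gr_implies_not0 neq0_conv one_less_numeral_iff power_strict_increasing semiring_norm(76))
    then show "e ^ 2 ^ i * 0 ^ (2 ^ (m - 1) - 2 ^ i) = (if i = m - 1 then e ^ 2 ^ i else 0)"
      by (auto simp: power_0_left)
  qed
  also have "\<dots> = e ^ 2 ^ (m - 1)" using m_ge by simp
  finally show ?thesis using e_nz by simp
qed

text \<open>Every nonzero field element is a root of \<open>denom\<close>, and both sides are monic
  of degree \<open>n\<close>.\<close>

lemma denom_eq: "denom = (\<Prod>a\<in>UNIV - {0}. [:-a, 1:])"
proof -
  let ?P = "\<Prod>a\<in>UNIV - {0::'a}. [:-a, 1:]"
  have "?P dvd denom"
    by (rule prod_linear_dvd) (auto simp: denom_def poly_monom pow_n c2)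
  then obtain k where k: "denom = ?P * k" by (rule dvdE)
  have dP: "degree ?P = n"
    by (subst degree_prod_sum_eq) (simp_all add: card_nz)
  have lP: "lead_coeff ?P = 1" by (simp add: lead_coeff_prod)
  have lt: "degree (1::'a poly) < degree (monom (1::'a) n)" using n_pos by (simp add: degree_monom_eq)
  have dd: "degree denom = n" unfolding denom_def using degree_add_eq_left[OF lt] by (simp add: degree_monom_eq)
  have ld: "lead_coeff denom = 1" unfolding dd unfolding denom_def using n_pos by simp
  have "k \<noteq> 0" "?P \<noteq> 0" using ld k by auto
  then have "degree k = 0" using k dP dd degree_mult_eq[of ?P k] by simp
  moreover have "lead_coeff k = 1" using ld lP unfolding k lead_coeff_mult by simp
  ultimately have "k = 1" by (metis degree_eq_zeroE lead_coeff_pCons(2) one_pCons)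
  then show ?thesis using k by simp
qed

text \<open>The Kloosterman sum enters through cancellation: \<open>numer\<close> and
  \<open>denom\<close> share the factor \<open>M\<close>, whose roots are exactly the elements
  counted by \<open>kloos e\<close>. With \<open>numer / denom = S / E\<close> reduced, the second
  abscissa \<open>S^2 / (t E^2)\<close> has height \<open>2 * (2 ^ m - kloos e)\<close>.\<close>

lemma kloosterman_chain:
  "(int k)\<^sup>2 + (int n - 2 * int (kloos e)) * int k + 2 ^ m \<ge> 0"
proof -
  note [simp] = char2_simps[OF char2_poly_ring]
  let ?h = "(2::nat) ^ (m - 1)"
  define Z where "Z = {a. a \<noteq> 0 \<and> poly numer a = 0}"
  have Z: "Z = {a. a \<noteq> 0 \<and> tr (a + e / a) = 1}"
  proof -
    have "1 + t = 0 \<longleftrightarrow> t = 1" for t :: 'a by (metis add_eq_0_iff c2(3))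
    then have "poly numer a = 0 \<longleftrightarrow> tr (a + e / a) = 1" if "a \<noteq> 0" for a
      unfolding poly_numer[OF that] mult_eq_0_iff using that by simp
    then show ?thesis unfolding Z_def by blast
  qed
  have Z_sub: "Z \<subseteq> UNIV - {0}" unfolding Z_def by auto
  define M where "M = (\<Prod>a\<in>Z. [:-a, 1:])"
  define E where "E = (\<Prod>a\<in>UNIV - {0} - Z. [:-a, 1:])"
  have ME: "denom = M * E"
    unfolding denom_eq M_def E_def by (subst prod.union_disjoint[symmetric]) (auto intro!: prod.cong simp: Z_def)
  have "M dvd numer" unfolding M_def by (rule prod_linear_dvd) (auto simp: Z_def)
  then obtain S where S: "numer = M * S" by (rule dvdE)
  have nz: "M \<noteq> 0" "E \<noteq> 0" "S \<noteq> 0"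
    using numer_degree S by (auto simp: M_def E_def)
  have zM: "degree M = kloos e" unfolding M_def kloos_def Z[symmetric]
    by (subst degree_prod_sum_eq) auto
  have lM: "lead_coeff M = 1" unfolding M_def by (simp add: lead_coeff_prod)
  have dE: "degree E = n - kloos e" unfolding E_def kloos_def Z[symmetric]
    by (subst degree_prod_sum_eq) (simp_all add: card_Diff_subset Z_sub card_nz)
  have z_le: "kloos e \<le> n" unfolding kloos_def card_nz[symmetric] by (rule card_mono) auto
  have dS: "degree S = 2 ^ m - kloos e"
    using numer_degree(1) degree_mult_eq[OF nz(1,3)] zM S by simp
  have dS2: "degree (S\<^sup>2) = 2 * (2 ^ m - kloos e)" using dS nz by (simp add: degree_power_eq)
  have lS2: "lead_coeff (S\<^sup>2) \<noteq> 0" using nz by simp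
  have Sa: "poly S a \<noteq> 0" if "a \<notin> Z" for a
  proof -
    have "poly numer a \<noteq> 0" using that poly_numer_0 by (cases "a = 0") (auto simp: Z_def)
    then show ?thesis unfolding S by simp
  qed
  \<comment> \<open>\<open>S\<close> vanishes neither at 0 nor at a root of \<open>E\<close>, so
    \<open>S^2 / (t E^2)\<close> is in lowest terms.\<close>
  have X: "comaximal S [:0, 1:]" using comaximal_linear[OF Sa, of 0] by (simp add: Z_def)
  have SE: "comaximal S E" unfolding E_def by (intro comaximal_prod comaximal_linear Sa) simp
  have co: "comaximal (S\<^sup>2) ([:0, 1:] * E\<^sup>2)"
    using comaximal_mult[OF X comaximal_power[OF SE, of 2]] comaximal_power2[of S _ 2 1] by simp
  have "top_degree (S\<^sup>2) ([:0, 1:] * E\<^sup>2) (2 * (2 ^ m - kloos e))"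
  proof -
    have "degree ([:0, 1:] * E\<^sup>2) = 1 + 2 * (n - kloos e)"
      using nz dE by (subst degree_mult_eq) (simp_all add: degree_power_eq)
    also have "\<dots> \<le> 2 * (2 ^ m - kloos e)" using z_le Suc_n by linarith
    finally show ?thesis using dS2 lS2 unfolding top_degree_def by simp
  qed
  moreover have "top_degree (monom 1 (2 ^ m)) (1::'a poly) (2 ^ m)"
    unfolding top_degree_def by (simp add: degree_monom_eq)
  moreover have "biquad [:0, 1:] [:e\<^sup>2:] (monom 1 (2 ^ m)) 1 (S\<^sup>2) ([:0, 1:] * E\<^sup>2) = 0"
  proof -
    define t q h c where "t = [:0, 1::'a:]" and "q = monom (1::'a) (2 ^ m)" and "h = monom (1::'a) ?h"
      and "c = [:e:]"
    have c2e: "[:e\<^sup>2:] = c\<^sup>2" by (simp add: c_def power2_eq_square)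
    have qh: "q = h\<^sup>2" by (simp add: q_def h_def power2_eq_square mult_monom half)
    have qt: "monom 1 (2 ^ m + 1) = t * q" by (simp add: t_def q_def monom_Suc)
    have dt: "q + t = t * denom"
      by (simp add: denom_def t_def q_def distrib_left monom_Suc flip: Suc_n)
    have "numer\<^sup>2 + h * numer = (t * q + c) * denom"
      using numer_eq unfolding qt h_def c_def .
    then have "numer\<^sup>2 + h * numer + (t * q + c) * denom = 0" by simp
    moreover have "numer\<^sup>2 + h * numer + (t * q + c) * denom
        = M * (M * S\<^sup>2 + h * S + (t * q + c) * E)"
      unfolding ME S by (simp add: power_mult_distrib power2_eq_square algebra_simps)
    ultimately have "M * (M * S\<^sup>2 + h * S + (t * q + c) * E) = 0" by simp
    then have "M * S\<^sup>2 + h * S + (t * q + c) * E = 0" using nz by simp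
    \<comment> \<open>Multiplying by \<open>t * E\<close> brings in
      \<open>q + t = t * denom\<close>; squaring replaces \<open>h\<close>, the square root of
      \<open>q\<close>, by \<open>q\<close> itself.\<close>
    then have "0 = (t * (E * (M * S\<^sup>2 + h * S + (t * q + c) * E)))\<^sup>2" by simp
    also have "t * (E * (M * S\<^sup>2 + h * S + (t * q + c) * E))
        = (q + t) * S\<^sup>2 + t * h * (S * E) + t * (t * q + c) * E\<^sup>2"
      unfolding dt ME by (simp add: power2_eq_square algebra_simps)
    also have "\<dots>\<^sup>2 = (q\<^sup>2 + t\<^sup>2) * S ^ 4 + t\<^sup>2 * q * (S\<^sup>2 * E\<^sup>2) + t\<^sup>2 * (t\<^sup>2 * q\<^sup>2 + c\<^sup>2) * E ^ 4"
      unfolding char2_square_add[OF char2_poly_ring] power_mult_distrib qh by simp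
    also have "\<dots> = biquad t (c\<^sup>2) q 1 (S\<^sup>2) (t * E\<^sup>2)"
      unfolding biquad_def char2_square_add[OF char2_poly_ring] power_mult_distrib
      by (simp add: power2_eq_square power4_eq_xxxx algebra_simps)
    finally show ?thesis unfolding c2e t_def q_def by simp
  qed
  moreover have "int (2 * (2 ^ m - kloos e)) = int (2 ^ m) + 1 + (int n - 2 * int (kloos e))"
    using z_le Suc_n by linarith
  moreover have "odd (int n - 2 * int (kloos e))"
    using odd_n by simp
  moreover have "even ((2::nat) ^ m)" using m_ge by simp
  moreover have "comaximal (monom 1 (2 ^ m)) (1::'a poly)" by (rule comaximal_1)
  ultimately show ?thesis
    using vieta_chain[OF char2, of "e\<^sup>2" "int n - 2 * int (kloos e)" "2 ^ m"] co e_nz by simp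
qed

text \<open>The polynomial \<open>x^2 - L x + 2^m\<close> is evaluated at
  \<open>k = (L - 1) / 2\<close>, the integer just below its vertex, giving
  \<open>k * (k + 1) \<le> 2 ^ m\<close>. This alone yields only
  \<open>L^2 \<le> 4 * 2 ^ m + 1\<close>, so equality is excluded separately.\<close>

theorem kloosterman_bound:
  assumes "int n < 2 * int (kloos e)"
  shows "(2 * int (kloos e) - int n)\<^sup>2 \<le> 4 * 2 ^ m"
proof -
  define L where "L = 2 * int (kloos e) - int n"
  have "odd L" unfolding L_def
    using odd_n by simp
  then obtain k where k: "L = 2 * k + 1" by (rule oddE)
  have "k \<ge> 0" using assms k unfolding L_def by linarith
  have "(int (nat k))\<^sup>2 - L * int (nat k) + 2 ^ m \<ge> 0"
    using kloosterman_chain[of "nat k"] unfolding L_def by (simp add: algebra_simps)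
  then have "k * k + k \<le> 2 ^ m" using \<open>k \<ge> 0\<close> by (simp add: k power2_eq_square algebra_simps)
  moreover have "k * k + k \<noteq> 2 ^ m"
    \<comment> \<open>one of the consecutive factors \<open>k\<close>, \<open>k + 1\<close> is odd and would have to be 1\<close>
  proof
    assume eq: "k * k + k = 2 ^ m"
    have "nat k * (nat k + 1) = 2 ^ m"
    proof -
      have "int (nat k * (nat k + 1)) = int (2 ^ m)" using eq \<open>k \<ge> 0\<close> by (simp add: algebra_simps)
      then show ?thesis by (simp only: of_nat_eq_iff)
    qed
    then have "nat k dvd 2 ^ m" "nat k + 1 dvd 2 ^ m" by (metis dvd_triv_left dvd_triv_right)+
    then obtain i j where ij: "nat k = 2 ^ i" "nat k + 1 = 2 ^ j"
      using divides_primepow_nat[OF two_is_prime_nat] by blast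
    have "i = 0 \<or> j = 0"
    proof (rule ccontr)
      assume "\<not> ?thesis"
      then have "even ((2::nat) ^ i)" "even ((2::nat) ^ j)" by auto
      then have "even (nat k)" "even (nat k + 1)" using ij by metis+
      then show False by simp
    qed
    then have "nat k \<le> 1" using ij by auto
    then have "nat k * (nat k + 1) \<le> 1 * 2" by (intro mult_mono) auto
    with \<open>nat k * (nat k + 1) = 2 ^ m\<close> show False using n_pos Suc_n by linarith
  qed
  ultimately have "k * k + k + 1 \<le> 2 ^ m" by linarith
  then have "L\<^sup>2 \<le> 4 * 2 ^ m" unfolding k by (simp add: power2_eq_square algebra_simps)
  then show ?thesis unfolding L_def .
qed

end

end

section \<open>Binary linear codes and duality\<close>

declare add_bit_eq_xor [simp del] mult_bit_eq_and [simp del]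

text \<open>The nontrivial additive character of the binary field.\<close>

definition sg :: "bit \<Rightarrow> int" where
  "sg b = (if b = 0 then 1 else -1)"

lemma bit_add_self: "b + b = (0::bit)"
  by (cases b) (simp_all add: add_bit_eq_xor)

lemma sg_simps [simp]: "sg 0 = 1" "sg 1 = -1"
  by (simp_all add: sg_def)

lemma sg_add: "sg (a + b) = sg a * sg b"
  by (cases a; cases b) (simp_all add: add_bit_eq_xor)

lemma sg_sum: "sg (\<Sum>i\<in>A. f i) = (\<Prod>i\<in>A. sg (f i))"
  by (induction A rule: infinite_finite_induct) (simp_all add: sg_add)

lemma bit_vec_add_self: "x \<in> carrier_vec n \<Longrightarrow> x + x = (0\<^sub>v n :: bit vec)"
  by (intro eq_vecI) (auto simp: bit_add_self)

definition ind_vec :: "nat \<Rightarrow> nat set \<Rightarrow> bit vec" where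
  "ind_vec n S = vec n (\<lambda>i. if i \<in> S then 1 else 0)"

definition support :: "bit vec \<Rightarrow> nat set" where
  "support x = {i. i < dim_vec x \<and> x $ i = 1}"

lemma ind_vec_carrier [simp]: "ind_vec n S \<in> carrier_vec n"
  by (simp add: ind_vec_def)

lemma support_subset: "x \<in> carrier_vec n \<Longrightarrow> support x \<subseteq> {..<n}"
  by (auto simp: support_def)

lemma finite_support [simp]: "finite (support x)"
  by (simp add: support_def)

lemma support_ind_vec: "S \<subseteq> {..<n} \<Longrightarrow> support (ind_vec n S) = S"
  by (auto simp: support_def ind_vec_def split: if_splits)

lemma ind_vec_support: "x \<in> carrier_vec n \<Longrightarrow> ind_vec n (support x) = x"
  by (intro eq_vecI) (auto simp: support_def ind_vec_def)

lemma bij_support: "bij_betw support (carrier_vec n) (Pow {..<n})"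
  by (rule bij_betw_byWitness[where f' = "ind_vec n"])
     (auto simp: ind_vec_support support_ind_vec dest: support_subset)

lemma finite_carrier_bit_vec [simp]: "finite (carrier_vec n :: bit vec set)"
  using bij_betw_finite[OF bij_support] by simp

lemma card_carrier_bit_vec: "card (carrier_vec n :: bit vec set) = 2 ^ n"
  using bij_betw_same_card[OF bij_support] by (simp add: card_Pow)

lemma support_empty_iff: "x \<in> carrier_vec n \<Longrightarrow> support x = {} \<longleftrightarrow> x = 0\<^sub>v n"
  by (auto simp: support_def intro!: eq_vecI)

lemma hamming_dist_support:
  assumes "x \<in> carrier_vec n" "y \<in> carrier_vec n"
  shows "hamming_dist x y = card (support (x + y))"
proof -
  have "a \<noteq> b \<longleftrightarrow> a + b = 1" for a b :: bit
    by (cases a; cases b) (simp_all add: add_bit_eq_xor)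
  then show ?thesis using assms unfolding hamming_dist_def support_def
    by (intro arg_cong[where f = card]) auto
qed

lemma scalar_prod_ind_vec:
  assumes "x \<in> carrier_vec n" "S \<subseteq> {..<n}"
  shows "x \<bullet> ind_vec n S = (\<Sum>i\<in>S. x $ i)"
proof -
  have "x \<bullet> ind_vec n S = (\<Sum>i\<in>{0..<n}. if i \<in> S then x $ i else 0)"
    unfolding scalar_prod_def ind_vec_def by (auto intro!: sum.cong)
  also have "\<dots> = (\<Sum>i\<in>S. x $ i)"
    using assms by (subst sum.inter_restrict[symmetric]) (auto intro!: sum.cong)
  finally show ?thesis .
qed

section \<open>Character sums, duality and orthogonal arrays\<close>

locale binary_linear_code =
  fixes n :: nat and D :: "bit vec set"
  assumes carrier: "D \<subseteq> carrier_vec n" and zero: "0\<^sub>v n \<in> D"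
    and add: "x \<in> D \<Longrightarrow> y \<in> D \<Longrightarrow> x + y \<in> D"
begin

lemma finite_D: "finite D"
  by (rule finite_subset[OF carrier]) simp

text \<open>If some \<open>v\<close> in \<open>D\<close> is not orthogonal to \<open>y\<close>,
  translation by \<open>v\<close> permutes \<open>D\<close> and changes the sign of every
  term.\<close>

lemma char_sum:
  assumes y: "y \<in> carrier_vec n"
  shows "(\<Sum>x\<in>D. sg (x \<bullet> y)) = (if y \<in> dual_code n D then int (card D) else 0)"
proof (cases "y \<in> dual_code n D")
  case True
  then show ?thesis by (simp add: dual_code_def)
next
  case False
  then obtain v where v: "v \<in> D" "v \<bullet> y \<noteq> 0" using y by (auto simp: dual_code_def)
  have cancel: "x + v + v = x" if "x \<in> D" for x
  proof -
    have "x \<in> carrier_vec n" "v \<in> carrier_vec n" using that v carrier by auto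
    then show ?thesis by (simp add: assoc_add_vec[of _ n] bit_vec_add_self)
  qed
  have "(\<Sum>x\<in>D. sg (x \<bullet> y)) = (\<Sum>x\<in>D. sg ((x + v) \<bullet> y))"
    by (rule sum.reindex_bij_witness[of _ "\<lambda>x. x + v" "\<lambda>x. x + v"]) (auto simp: add v cancel)
  also have "\<dots> = (\<Sum>x\<in>D. - sg (x \<bullet> y))"
  proof (rule sum.cong[OF refl])
    fix x assume "x \<in> D"
    then have "(x + v) \<bullet> y = x \<bullet> y + v \<bullet> y"
      using v y carrier by (intro add_scalar_prod_distrib[of _ n]) auto
    then show "sg ((x + v) \<bullet> y) = - sg (x \<bullet> y)" using v(2) by (simp add: sg_add)
  qed
  finally show ?thesis using False by (simp add: sum_negf)
qed

lemma dual_linear: "binary_linear_code n (dual_code n D)"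
proof
  show "x + y \<in> dual_code n D" if "x \<in> dual_code n D" "y \<in> dual_code n D" for x y
    using that carrier by (auto simp: dual_code_def scalar_prod_add_distrib[of _ n] subset_iff)
qed (use carrier in \<open>auto simp: dual_code_def subset_iff\<close>)

end

lemma binary_linear_code_carrier: "binary_linear_code n (carrier_vec n)"
  by unfold_locales auto

lemma dual_carrier: "dual_code n (carrier_vec n) = {0\<^sub>v n}"
proof -
  have "y = 0\<^sub>v n" if y: "y \<in> dual_code n (carrier_vec n)" for y
  proof (intro eq_vecI)
    fix i assume "i < dim_vec (0\<^sub>v n :: bit vec)"
    then have i: "i < n" by simp
    have "unit_vec n i \<bullet> y = 0" "y \<in> carrier_vec n" using y by (auto simp: dual_code_def)
    then show "y $ i = 0\<^sub>v n $ i" using i by (simp add: scalar_prod_left_unit[of _ n])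
  qed (use y in \<open>auto simp: dual_code_def\<close>)
  then show ?thesis by (auto simp: dual_code_def)
qed

context binary_linear_code
begin

text \<open>Double counting: the sum of \<open>sg (x \<bullet> y)\<close> over all \<open>x\<close>
  in \<open>D\<close> and all vectors \<open>y\<close> is evaluated by \<open>char_sum\<close> in
  either order.\<close>

lemma card_dual: "card D * card (dual_code n D) = 2 ^ n"
proof -
  interpret F: binary_linear_code n "carrier_vec n" by (rule binary_linear_code_carrier)
  have fin: "finite (dual_code n D)" by (rule finite_subset[of _ "carrier_vec n"]) (auto simp: dual_code_def)
  have "(\<Sum>y\<in>carrier_vec n. \<Sum>x\<in>D. sg (x \<bullet> y)) = (\<Sum>y\<in>carrier_vec n. if y \<in> dual_code n D then int (card D) else 0)"
    by (rule sum.cong) (simp_all add: char_sum)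
  also have "\<dots> = (\<Sum>y\<in>carrier_vec n \<inter> dual_code n D. int (card D))"
    by (subst sum.inter_restrict) auto
  also have "carrier_vec n \<inter> dual_code n D = dual_code n D" by (auto simp: dual_code_def)
  finally have 1: "(\<Sum>y\<in>carrier_vec n. \<Sum>x\<in>D. sg (x \<bullet> y)) = int (card D) * int (card (dual_code n D))"
    by simp
  have "(\<Sum>y\<in>carrier_vec n. \<Sum>x\<in>D. sg (x \<bullet> y)) = (\<Sum>x\<in>D. \<Sum>y\<in>carrier_vec n. sg (y \<bullet> x))"
    by (subst sum.swap) (use carrier in \<open>auto intro!: sum.cong simp: comm_scalar_prod[of _ n] subset_iff\<close>)
  also have "\<dots> = (\<Sum>x\<in>D. if x = 0\<^sub>v n then 2 ^ n else 0)"
    by (rule sum.cong) (use carrier in \<open>auto simp: F.char_sum dual_carrier card_carrier_bit_vec subset_iff\<close>)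
  also have "\<dots> = 2 ^ n" using zero finite_D by simp
  finally have "int (card D * card (dual_code n D)) = int (2 ^ n)" using 1 by simp
  then show ?thesis by (simp only: of_nat_eq_iff)
qed

text \<open>One inclusion is clear, and \<open>card_dual\<close>, applied to \<open>D\<close> and to
  its dual, makes the cardinalities equal.\<close>

lemma double_dual: "dual_code n (dual_code n D) = D"
proof -
  interpret E: binary_linear_code n "dual_code n D" by (rule dual_linear)
  have "D \<subseteq> dual_code n (dual_code n D)"
    using carrier by (auto simp: dual_code_def comm_scalar_prod[of _ n] subset_iff)
  moreover have "card (dual_code n (dual_code n D)) = card D"
  proof -
    have "card D * card (dual_code n D) = card (dual_code n (dual_code n D)) * card (dual_code n D)"
      using card_dual E.card_dual by (simp add: mult.commute)
    moreover have "card (dual_code n D) \<noteq> 0" using card_dual by (metis mult_0_right power_not_zero zero_neq_numeral)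
    ultimately show ?thesis by simp
  qed
  moreover have "finite (dual_code n (dual_code n D))"
    by (rule finite_subset[of _ "carrier_vec n"]) (auto simp: dual_code_def)
  ultimately show ?thesis by (metis card_subset_eq)
qed

text \<open>The indicator of agreement with \<open>w\<close> on \<open>T\<close>, times
  \<open>2 ^ t\<close>, is a product of factors \<open>1 + sg (x $ i + w i)\<close>. Expanded, it is
  a sum of characters indexed by subsets \<open>S\<close> of \<open>T\<close>; by the dual distance
  all but the one for \<open>S = {}\<close> sum to 0 over \<open>D\<close>.\<close>

lemma orthogonal_array_if_dual_distance:
  assumes t: "t \<le> n" and dist: "\<And>x. x \<in> dual_code n D \<Longrightarrow> x \<noteq> 0\<^sub>v n \<Longrightarrow> card (support x) > t"
  shows "orthogonal_array n D t"
  unfolding orthogonal_array_def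
proof (intro conjI allI impI)
  fix T w assume T: "T \<subseteq> {..<n} \<and> card T = t"
  then have fT: "finite T" using finite_subset by blast
  let ?N = "{x \<in> D. \<forall>i\<in>T. x $ i = w i}"
  have ind: "(\<Prod>i\<in>T. sg (x $ i + w i) + 1) = (if \<forall>i\<in>T. x $ i = w i then 2 ^ t else 0)" for x
  proof -
    have *: "sg (a + b) + 1 = (if a = b then 2 else 0)" for a b
      by (cases a; cases b) (simp_all add: add_bit_eq_xor)
    have "(\<Prod>i\<in>T. if x $ i = w i then 2 else 0) = (if \<forall>i\<in>T. x $ i = w i then 2 ^ t else (0::int))"
      using T fT by (auto simp: prod_zero_iff)
    then show ?thesis by (simp only: *)
  qed
  have "2 ^ t * int (card ?N) = (\<Sum>x\<in>D. if \<forall>i\<in>T. x $ i = w i then 2 ^ t else 0)"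
    using finite_D by (simp add: sum.If_cases Int_def)
  also have "\<dots> = (\<Sum>x\<in>D. \<Prod>i\<in>T. sg (x $ i + w i) + 1)" by (simp only: ind)
  also have "\<dots> = (\<Sum>x\<in>D. \<Sum>S\<in>Pow T. \<Prod>i\<in>S. sg (x $ i + w i))"
    by (simp add: prod_add[OF fT])
  also have "\<dots> = (\<Sum>S\<in>Pow T. \<Sum>x\<in>D. \<Prod>i\<in>S. sg (x $ i + w i))" by (rule sum.swap)
  also have "\<dots> = (\<Sum>S\<in>Pow T. if S = {} then int (card D) else 0)"
  proof (rule sum.cong[OF refl])
    fix S assume "S \<in> Pow T"
    then have S: "S \<subseteq> {..<n}" "S \<subseteq> T" using T by auto
    have "(\<Sum>x\<in>D. \<Prod>i\<in>S. sg (x $ i + w i)) = (\<Sum>x\<in>D. (\<Prod>i\<in>S. sg (w i)) * sg (x \<bullet> ind_vec n S))"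
      using carrier S
      by (intro sum.cong) (auto simp: scalar_prod_ind_vec sg_sum sg_add prod.distrib subset_iff)
    also have "\<dots> = (\<Prod>i\<in>S. sg (w i)) * (if ind_vec n S \<in> dual_code n D then int (card D) else 0)"
      by (simp add: char_sum flip: sum_distrib_left)
    also have "\<dots> = (if S = {} then int (card D) else 0)"
    proof (cases "S = {}")
      case True
      have "ind_vec n {} = 0\<^sub>v n" by (auto simp: ind_vec_def)
      then show ?thesis using True carrier by (auto simp: dual_code_def subset_iff)
    next
      case False
      have "card S \<le> t" using T S fT by (metis card_mono)
      moreover have "ind_vec n S \<noteq> 0\<^sub>v n"
        using False S support_ind_vec[of S n] support_empty_iff[of "ind_vec n S" n] by simp
      ultimately have "ind_vec n S \<notin> dual_code n D"
        using dist[of "ind_vec n S"] S by (auto simp: support_ind_vec)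
      then show ?thesis using False by simp
    qed
    finally show "(\<Sum>x\<in>D. \<Prod>i\<in>S. sg (x $ i + w i)) = (if S = {} then int (card D) else 0)" .
  qed
  also have "\<dots> = int (card D)" using fT by simp
  finally have "real_of_int (2 ^ t * int (card ?N)) = real_of_int (int (card D))" by simp
  then show "real (card ?N) = real (card D) / 2 ^ t" by (simp add: field_simps)
qed (use t carrier in auto)

lemma min_distance_eq:
  assumes "x\<^sub>0 \<in> D" "x\<^sub>0 \<noteq> 0\<^sub>v n" "card (support x\<^sub>0) = d"
    and "\<And>x. x \<in> D \<Longrightarrow> x \<noteq> 0\<^sub>v n \<Longrightarrow> card (support x) \<ge> d"
  shows "min_distance D = d"
  unfolding min_distance_def
proof (rule Min_eqI)
  have "{hamming_dist x y | x y. x \<in> D \<and> y \<in> D \<and> x \<noteq> y} \<subseteq> (\<lambda>(x, y). hamming_dist x y) ` (D \<times> D)"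
    by auto
  then show "finite {hamming_dist x y | x y. x \<in> D \<and> y \<in> D \<and> x \<noteq> y}"
    using finite_D finite_subset by blast
  have "hamming_dist x\<^sub>0 (0\<^sub>v n) = d" using assms(1,3) carrier
    by (subst hamming_dist_support[of _ n]) auto
  then show "d \<in> {hamming_dist x y | x y. x \<in> D \<and> y \<in> D \<and> x \<noteq> y}"
    using assms(1,2) zero by blast
next
  fix e assume "e \<in> {hamming_dist x y | x y. x \<in> D \<and> y \<in> D \<and> x \<noteq> y}"
  then obtain x y where e: "e = hamming_dist x y" and xy: "x \<in> D" "y \<in> D" "x \<noteq> y" by blast
  have c: "x \<in> carrier_vec n" "y \<in> carrier_vec n" using xy carrier by auto
  have "x + y \<noteq> 0\<^sub>v n"
  proof
    assume 0: "x + y = 0\<^sub>v n"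
    have "a = b" if "a + b = 0" for a b :: bit
      using that by (cases a; cases b) (simp_all add: add_bit_eq_xor)
    moreover have "x $ i + y $ i = 0" if "i < n" for i
      using arg_cong[OF 0, of "\<lambda>v. v $ i"] that c by auto
    ultimately have "x = y" using c by (intro eq_vecI) auto
    with xy show False by simp
  qed
  then show "d \<le> e" using assms(4)[OF add[OF xy(1,2)]] e xy carrier
    by (auto simp: hamming_dist_support[of _ n] subset_iff)
qed

end

lemma covering_radius_ge:
  assumes "D \<subseteq> carrier_vec n" "D \<noteq> {}" "y \<in> carrier_vec n"
    and "\<And>x. x \<in> D \<Longrightarrow> hamming_dist x y \<ge> d"
  shows "covering_radius n D \<ge> d"
proof -
  have "finite D" by (rule finite_subset[OF assms(1)]) simp
  then have "d \<le> Min ((\<lambda>x. hamming_dist x y) ` D)"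
    using assms(2,4) by (intro Min.boundedI) auto
  also have "\<dots> \<le> covering_radius n D" unfolding covering_radius_def
    by (rule Max_ge) (use assms(3) in auto)
  finally show ?thesis .
qed

section \<open>Melas codes\<close>

context binary_field
begin

section \<open>Evaluation of binary polynomials, minimal polynomials and syndromes\<close>

definition emb :: "bit \<Rightarrow> 'a" where
  "emb b = (if b = 0 then 0 else 1)"

lemma emb_simps [simp]: "emb 0 = 0" "emb 1 = 1"
  by (simp_all add: emb_def)

lemma of_bit_eq_emb: "(of_bit b :: 'a) = emb b"
  by (cases b) simp_all

lemma emb_add: "emb (a + b) = emb a + emb b"
  by (cases a; cases b) (simp_all add: add_bit_eq_xor c2)

lemma emb_mult: "emb (a * b) = emb a * emb b"
  by (cases a; cases b) (simp_all add: mult_bit_eq_and)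

lemma emb_sum: "emb (\<Sum>i\<in>A. f i) = (\<Sum>i\<in>A. emb (f i))"
  by (induction A rule: infinite_finite_induct) (simp_all add: emb_add)

lemma eval_at_alt: "eval_at p (x::'a) = poly (map_poly emb p) x"
proof -
  have "(of_bit :: bit \<Rightarrow> 'a) = emb" by (rule ext) (rule of_bit_eq_emb)
  then show ?thesis by (simp add: eval_at_def)
qed

lemma eval_at_mult: "eval_at (p * r) (x::'a) = eval_at p x * eval_at r x"
proof -
  have "map_poly emb (p * r) = map_poly emb p * map_poly emb r"
    by (rule poly_eqI) (simp add: coeff_map_poly coeff_mult emb_sum emb_mult)
  then show ?thesis by (simp add: eval_at_alt)
qed

lemma eval_at_add: "eval_at (p + r) (x::'a) = eval_at p x + eval_at r x"
proof -
  have "map_poly emb (p + r) = map_poly emb p + map_poly emb r"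
    by (rule poly_eqI) (simp add: coeff_map_poly emb_add)
  then show ?thesis by (simp add: eval_at_alt)
qed

lemma bit_poly_char2: "(2 :: bit poly) = 0"
  by (rule char2_poly) simp

lemma eval_at_diff: "eval_at (p - r) (x::'a) = eval_at p x - eval_at r x"
  unfolding char2_simps(4)[OF bit_poly_char2] eval_at_add c2(4) ..

lemma min_poly_dvd:
  assumes "is_min_poly (x::'a) g" "eval_at p x = 0"
  shows "g dvd p"
proof -
  have "g \<noteq> 0" using assms(1) by (auto simp: is_min_poly_def)
  have "eval_at (p mod g) x = 0"
  proof -
    have "p mod g = p - g * (p div g)" by (simp add: minus_mult_div_eq_mod)
    then show ?thesis using assms by (simp add: eval_at_diff eval_at_mult is_min_poly_def)
  qed
  then have "p mod g = 0"
    using assms(1) degree_mod_less[OF \<open>g \<noteq> 0\<close>, of p] unfolding is_min_poly_def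
    by (metis linorder_not_less)
  then show ?thesis by (simp only: mod_eq_0_iff_dvd)
qed

definition syn :: "'a \<Rightarrow> bit vec \<Rightarrow> 'a" where
  "syn x y = (\<Sum>i<n. emb (y $ i) * x ^ i)"

lemma syn_coeff:
  assumes "degree p < n"
  shows "syn x (vec n (coeff p)) = eval_at p x"
proof -
  have "degree (map_poly emb p) \<le> degree p" by (rule degree_le) (simp add: coeff_map_poly coeff_eq_0)
  then have "eval_at p x = (\<Sum>i<n. coeff (map_poly emb p) i * x ^ i)"
    unfolding eval_at_alt poly_altdef using assms
    by (intro sum.mono_neutral_left) (auto simp: coeff_eq_0)
  then show ?thesis by (simp add: syn_def coeff_map_poly)
qed

definition vec_poly :: "bit vec \<Rightarrow> bit poly" where
  "vec_poly y = (\<Sum>i<n. monom (y $ i) i)"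

lemma vec_coeff_vec_poly:
  assumes "y \<in> carrier_vec n"
  shows "vec n (coeff (vec_poly y)) = y" "degree (vec_poly y) < n"
proof -
  show "vec n (coeff (vec_poly y)) = y"
    using assms by (intro eq_vecI) (auto simp: vec_poly_def coeff_sum)
  show "degree (vec_poly y) < n" unfolding vec_poly_def
    by (rule degree_sum_less) (use n_pos in \<open>auto intro: le_less_trans[OF degree_monom_le]\<close>)
qed

section \<open>The trace words \<open>c(a,b)\<close> and the Melas code as their dual\<close>

definition bitr :: "'a \<Rightarrow> bit" where
  "bitr x = (if tr x = 0 then 0 else 1)"

lemma bitr_0 [simp]: "bitr 0 = 0"
  by (simp add: bitr_def)

lemma bitr_add: "bitr (x + y) = bitr x + bitr y"
  using tr_01[of x] tr_01[of y] unfolding bitr_def tr_add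
  by (auto simp: add_bit_eq_xor c2)

lemma bitr_sum: "bitr (\<Sum>i\<in>A. f i) = (\<Sum>i\<in>A. bitr (f i))"
  by (induction A rule: infinite_finite_induct) (simp_all add: bitr_add)

lemma bitr_emb: "bitr (emb b * x) = b * bitr x"
  by (cases b) (simp_all add: mult_bit_eq_and)

lemma bitr_eq_1: "bitr x = 1 \<longleftrightarrow> tr x = 1"
  using tr_01[of x] by (auto simp: bitr_def)

lemma bitr_nondegenerate:
  assumes "\<And>a. bitr (a * x) = 0"
  shows "x = 0"
proof (rule ccontr)
  assume "x \<noteq> 0"
  obtain y where "tr y = 1" using tr_onto by blast
  then have "bitr (y / x * x) = 1" using \<open>x \<noteq> 0\<close> by (simp add: bitr_eq_1)
  then show False using assms[of "y / x"] by (metis zero_neq_one)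
qed

definition cw :: "'a \<Rightarrow> 'a \<Rightarrow> bit vec" where
  "cw a b = vec n (\<lambda>i. bitr (a * \<theta> ^ i + b * inverse \<theta> ^ i))"

lemma cw_carrier [simp]: "cw a b \<in> carrier_vec n"
  by (simp add: cw_def)

lemma cw_add: "cw a b + cw c d = cw (a + c) (b + d)"
  unfolding cw_def by (intro eq_vecI) (auto simp: distrib_right bitr_add add_ac)

lemma cw_0: "cw 0 0 = 0\<^sub>v n"
  by (intro eq_vecI) (auto simp: cw_def)

text \<open>Trace duality: as the trace form is nondegenerate, \<open>y\<close> is orthogonal to all
  \<open>cw a b\<close> exactly when both syndromes vanish.\<close>

lemma scalar_prod_cw:
  assumes "y \<in> carrier_vec n"
  shows "cw a b \<bullet> y = bitr (a * syn \<theta> y + b * syn (inverse \<theta>) y)"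
proof -
  have "cw a b \<bullet> y = (\<Sum>i<n. bitr (emb (y $ i) * (a * \<theta> ^ i + b * inverse \<theta> ^ i)))"
    using assms unfolding scalar_prod_def cw_def
    by (intro sum.cong) (auto simp: bitr_emb mult.commute)
  also have "\<dots> = bitr (a * syn \<theta> y + b * syn (inverse \<theta>) y)"
    unfolding syn_def bitr_sum[symmetric] sum_distrib_left sum.distrib[symmetric]
    by (simp add: distrib_left mult_ac)
  finally show ?thesis .
qed

text \<open>On nonzero \<open>x\<close> the function \<open>tr (a * x + b / x)\<close> is a
  polynomial of degree at most \<open>n - 1\<close>. If it has all \<open>n\<close> nonzero elements
  as roots it is 0, and its coefficients at 1 and \<open>n - 1\<close> are \<open>a\<close> and
  \<open>b\<close>.\<close>

lemma cw_eq_0: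
  assumes "cw a b = 0\<^sub>v n"
  shows "a = 0 \<and> b = 0"
proof -
  have tr0: "tr (a * x + b / x) = 0" if "x \<noteq> 0" for x
  proof -
    from that obtain i where i: "i < n" "x = \<theta> ^ i" by (rule theta_power_cases)
    then have "bitr (a * x + b / x) = cw a b $ i" by (simp add: cw_def divide_inverse power_inverse)
    also have "\<dots> = 0" using assms i by simp
    finally show ?thesis by (simp add: bitr_def split: if_splits)
  qed
  \<comment> \<open>This keeps the exponents \<open>2 ^ i\<close> away from \<open>n - 1\<close> and
    the exponents \<open>n - 2 ^ i\<close> away from 1, so the two coefficients do not mix.\<close>
  have lt: "(2::nat) ^ i < n - 1" if "i < m" for i
  proof -
    have "(2::nat) ^ i \<le> 2 ^ (m - 1)" by (rule power_increasing) (use that in auto)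
    then show ?thesis using half n_pos Suc_n by linarith
  qed
  define p where "p = (\<Sum>i<m. monom (a ^ 2 ^ i) (2 ^ i)) + (\<Sum>i<m. monom (b ^ 2 ^ i) (n - 2 ^ i))"
  have "poly p x = 0" if "x \<noteq> 0" for x
  proof -
    have inv: "x ^ (n - 2 ^ i) = inverse (x ^ 2 ^ i)" if "i < m" for i
      using lt[OF that] \<open>x \<noteq> 0\<close> by (simp add: power_diff pow_n divide_inverse)
    have "poly p x = tr (a * x) + tr (b / x)"
      unfolding p_def tr_def
      by (simp add: poly_sum poly_monom power_mult_distrib power_divide inv divide_inverse power_inverse)
    then show ?thesis using tr0[OF that] by (simp add: tr_add)
  qed
  then have roots: "UNIV - {0} \<subseteq> {x. poly p x = 0}" by auto
  have "degree p \<le> n - 1"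
    unfolding p_def
  proof (intro degree_add_le degree_sum_le)
    show "degree (monom (a ^ 2 ^ i) (2 ^ i)) \<le> n - 1" if "i \<in> {..<m}" for i
      using lt[of i] that by (intro order.trans[OF degree_monom_le]) simp
    show "degree (monom (b ^ 2 ^ i) (n - 2 ^ i)) \<le> n - 1" if "i \<in> {..<m}" for i
      using n_pos by (intro order.trans[OF degree_monom_le]) (simp add: diff_le_mono2)
  qed auto
  have "p = 0"
  proof (rule ccontr)
    assume "p \<noteq> 0"
    then have "card {x. poly p x = 0} \<le> n - 1"
      using card_poly_roots_bound[of p] \<open>degree p \<le> n - 1\<close> by linarith
    moreover have "n \<le> card {x. poly p x = 0}"
      using card_mono[OF _ roots] card_nz by simp
    ultimately show False using n_pos by linarith
  qed
  have "coeff p 1 = (\<Sum>i<m. if i = 0 then a else 0) + (\<Sum>i<m. 0)"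
    unfolding p_def coeff_add coeff_sum
    by (intro arg_cong2[where f = "(+)"] sum.cong refl) (auto dest: lt)
  then have "a = 0" using \<open>p = 0\<close> m_ge by simp
  have "coeff p (n - 1) = (\<Sum>i<m. 0) + (\<Sum>i<m. if i = 0 then b else 0)"
    unfolding p_def coeff_add coeff_sum
  proof (intro arg_cong2[where f = "(+)"] sum.cong refl)
    show "coeff (monom (a ^ 2 ^ i) (2 ^ i)) (n - 1) = 0" if "i \<in> {..<m}" for i
      using lt[of i] that by simp
    show "coeff (monom (b ^ 2 ^ i) (n - 2 ^ i)) (n - 1) = (if i = 0 then b else 0)" if "i \<in> {..<m}" for i
    proof (cases "i = 0")
      case False
      have "n - 2 ^ i \<noteq> n - 1"
      proof
        assume "n - 2 ^ i = n - 1"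
        then have "(2::nat) ^ i = 1" using lt[of i] that n_pos unfolding lessThan_iff by linarith
        then show False using False by simp
      qed
      then show ?thesis using False by simp
    qed simp
  qed
  then have "b = 0" using \<open>p = 0\<close> m_ge by simp
  with \<open>a = 0\<close> show ?thesis by simp
qed

lemma cw_inject: "cw a b = cw c d \<longleftrightarrow> a = c \<and> b = d"
proof
  assume "cw a b = cw c d"
  then have "cw (a + c) (b + d) = 0\<^sub>v n"
    by (metis bit_vec_add_self cw_add cw_carrier)
  then have "a + c = 0" "b + d = 0" using cw_eq_0 by auto
  then show "a = c \<and> b = d" by (metis add_eq_0_iff c2(3))
qed simp

definition kloos_code :: "bit vec set" where
  "kloos_code = range (\<lambda>(a, b). cw a b)"

sublocale kloos: binary_linear_code n kloos_code
proof
  show "0\<^sub>v n \<in> kloos_code" unfolding kloos_code_def by (metis (mono_tags) cw_0 case_prod_conv rangeI)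
  show "x + y \<in> kloos_code" if "x \<in> kloos_code" "y \<in> kloos_code" for x y
    using that unfolding kloos_code_def by (auto simp: cw_add intro: range_eqI[of _ _ "(_, _)"])
qed (auto simp: kloos_code_def)

lemma card_kloos_code: "card kloos_code = 2 ^ (2 * m)"
proof -
  have "inj (\<lambda>(a, b). cw a b)" by (auto simp: inj_def cw_inject)
  then have "card kloos_code = card (UNIV :: ('a \<times> 'a) set)"
    unfolding kloos_code_def by (rule card_image)
  also have "\<dots> = 2 ^ m * 2 ^ m"
    unfolding UNIV_Times_UNIV[symmetric] card_cartesian_product card_UNIV ..
  finally show ?thesis by (simp add: mult_2 power_add)
qed

lemma dual_kloos_code:
  "dual_code n kloos_code = {y \<in> carrier_vec n. syn \<theta> y = 0 \<and> syn (inverse \<theta>) y = 0}"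
proof -
  have "syn \<theta> y = 0 \<and> syn (inverse \<theta>) y = 0" if "y \<in> dual_code n kloos_code" for y
  proof -
    have y: "y \<in> carrier_vec n" "cw a b \<bullet> y = 0" for a b
      using that by (auto simp: dual_code_def kloos_code_def)
    have "bitr (a * syn \<theta> y) = 0" "bitr (a * syn (inverse \<theta>) y) = 0" for a
      using y(2)[of a 0] y(2)[of 0 a] by (simp_all add: scalar_prod_cw[OF y(1)])
    then show ?thesis using bitr_nondegenerate by blast
  qed
  moreover have "y \<in> dual_code n kloos_code"
    if "y \<in> carrier_vec n" "syn \<theta> y = 0" "syn (inverse \<theta>) y = 0" for y
  proof -
    have "cw a b \<bullet> y = 0" for a b using that by (simp add: scalar_prod_cw)
    then show ?thesis using that(1) by (auto simp: dual_code_def kloos_code_def)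
  qed
  moreover have "dual_code n kloos_code \<subseteq> carrier_vec n" by (auto simp: dual_code_def)
  ultimately show ?thesis by blast
qed

text \<open>
  If \<open>\<theta>\<close> and \<open>\<theta>\<^sup>-\<^sup>1\<close> had the same minimal polynomial, \<open>cw 0 1\<close> would be orthogonal to the
  dual of the code of all \<open>cw a 0\<close>, hence belong to that code.
\<close>
lemma min_poly_inverse_neq:
  assumes "is_min_poly \<theta> g"
  shows "eval_at g (inverse \<theta>) \<noteq> 0"
proof
  assume 0: "eval_at g (inverse \<theta>) = 0"
  let ?D = "range (\<lambda>a. cw a 0)"
  interpret D: binary_linear_code n ?D
  proof
    show "0\<^sub>v n \<in> ?D" by (metis cw_0 rangeI)
    show "x + y \<in> ?D" if "x \<in> ?D" "y \<in> ?D" for x y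
      using that by (auto simp: cw_add)
  qed auto
  have "y \<bullet> cw 0 1 = 0" if "y \<in> dual_code n ?D" for y
  proof -
    have y: "y \<in> carrier_vec n" "cw a 0 \<bullet> y = 0" for a using that by (auto simp: dual_code_def)
    then have "syn \<theta> y = 0" using bitr_nondegenerate by (simp add: scalar_prod_cw)
    then have "eval_at (vec_poly y) \<theta> = 0"
      using syn_coeff[OF vec_coeff_vec_poly(2)[OF y(1)]] vec_coeff_vec_poly(1)[OF y(1)] by simp
    then have "g dvd vec_poly y" by (rule min_poly_dvd[OF assms])
    then have "eval_at (vec_poly y) (inverse \<theta>) = 0" using 0 by (auto simp: eval_at_mult elim: dvdE)
    then have "syn (inverse \<theta>) y = 0"
      using syn_coeff[OF vec_coeff_vec_poly(2)[OF y(1)]] vec_coeff_vec_poly(1)[OF y(1)] by simp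
    then have "cw 0 1 \<bullet> y = 0" using y(1) by (simp add: scalar_prod_cw)
    then show ?thesis using y(1) by (simp add: comm_scalar_prod[of _ n])
  qed
  then have "cw 0 1 \<in> dual_code n (dual_code n ?D)" by (simp add: dual_code_def)
  then have "cw 0 1 \<in> ?D" unfolding D.double_dual .
  then show False by (auto simp: cw_inject)
qed

text \<open>Reduction modulo \<open>x^n - 1\<close> does not change values at nonzero field
  elements. Conversely, \<open>g\<^sub>1\<close> divides the polynomial of a word with zero
  syndromes, and \<open>g\<^sub>2\<close> divides the cofactor because the inverse of
  \<open>\<theta>\<close> is no root of \<open>g\<^sub>1\<close>.\<close>

lemma cyclic_code_eq:
  assumes "is_min_poly \<theta> g\<^sub>1" "is_min_poly (inverse \<theta>) g\<^sub>2"
  shows "cyclic_code n (g\<^sub>1 * g\<^sub>2) = dual_code n kloos_code"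
  unfolding dual_kloos_code
proof (intro equalityI subsetI)
  fix y assume "y \<in> cyclic_code n (g\<^sub>1 * g\<^sub>2)"
  then obtain p h where p: "y = vec n (coeff p)" "degree p < n"
    "[p = g\<^sub>1 * g\<^sub>2 * h] (mod (monom 1 n - 1))" by (auto simp: cyclic_code_def)
  then obtain k where "p - g\<^sub>1 * g\<^sub>2 * h = (monom 1 n - 1) * k"
    unfolding cong_iff_dvd_diff by (auto elim: dvdE)
  then have k: "p = g\<^sub>1 * g\<^sub>2 * h + (monom 1 n - 1) * k" by (metis add.commute diff_add_cancel)
  have "eval_at p x = 0" if "x \<noteq> 0" "eval_at g\<^sub>1 x = 0 \<or> eval_at g\<^sub>2 x = 0" for x :: 'a
  proof -
    have "eval_at (monom 1 n) x = x ^ n" "eval_at 1 x = 1"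
      by (simp_all add: eval_at_alt map_poly_monom poly_monom map_poly_1)
    then show ?thesis using that pow_n unfolding k by (auto simp: eval_at_add eval_at_mult eval_at_diff)
  qed
  then have "eval_at p \<theta> = 0" "eval_at p (inverse \<theta>) = 0"
    using assms theta_nz by (auto simp: is_min_poly_def)
  then show "y \<in> {y \<in> carrier_vec n. syn \<theta> y = 0 \<and> syn (inverse \<theta>) y = 0}"
    using p by (simp add: syn_coeff)
next
  fix y assume "y \<in> {y \<in> carrier_vec n. syn \<theta> y = 0 \<and> syn (inverse \<theta>) y = 0}"
  then have y: "y \<in> carrier_vec n" and s: "syn \<theta> y = 0" "syn (inverse \<theta>) y = 0" by auto
  have ev: "eval_at (vec_poly y) x = syn x y" for x
    using syn_coeff[OF vec_coeff_vec_poly(2)[OF y]] vec_coeff_vec_poly(1)[OF y] by simp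
  obtain r where r: "vec_poly y = g\<^sub>1 * r"
    using min_poly_dvd[OF assms(1)] ev s by (metis dvdE)
  have "eval_at r (inverse \<theta>) = 0"
    using ev[of "inverse \<theta>"] s(2) min_poly_inverse_neq[OF assms(1)] unfolding r eval_at_mult by simp
  then obtain h where "r = g\<^sub>2 * h" using min_poly_dvd[OF assms(2)] by (metis dvdE)
  then have "[vec_poly y = g\<^sub>1 * g\<^sub>2 * h] (mod (monom 1 n - 1))" using r by (simp add: mult.assoc)
  then show "y \<in> cyclic_code n (g\<^sub>1 * g\<^sub>2)"
    using vec_coeff_vec_poly[OF y] unfolding cyclic_code_def mem_Collect_eq by metis
qed

section \<open>Words of the Melas code as sets of field elements\<close>

lemma support_syn:
  assumes "y \<in> carrier_vec n"
  shows "syn \<theta> y = (\<Sum>i\<in>support y. \<theta> ^ i)" "syn (inverse \<theta>) y = (\<Sum>i\<in>support y. inverse (\<theta> ^ i))"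
proof -
  have *: "syn x y = (\<Sum>i\<in>support y. x ^ i)" for x
  proof -
    have "syn x y = (\<Sum>i<n. if i \<in> support y then x ^ i else 0)"
      unfolding syn_def using assms by (intro sum.cong) (auto simp: support_def emb_def)
    also have "\<dots> = (\<Sum>i\<in>{..<n} \<inter> support y. x ^ i)" by (subst sum.inter_restrict) auto
    also have "{..<n} \<inter> support y = support y" using support_subset[OF assms] by blast
    finally show ?thesis .
  qed
  show "syn \<theta> y = (\<Sum>i\<in>support y. \<theta> ^ i)" by (rule *)
  show "syn (inverse \<theta>) y = (\<Sum>i\<in>support y. inverse (\<theta> ^ i))" by (simp add: * power_inverse)
qed

text \<open>The words of the Melas code correspond to such sets by taking the support.\<close>
definition melas_set :: "'a set \<Rightarrow> bool" where
  "melas_set A \<longleftrightarrow> 0 \<notin> A \<and> (\<Sum>a\<in>A. a) = 0 \<and> (\<Sum>a\<in>A. inverse a) = 0"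

lemma melas_set_of_word:
  assumes "y \<in> dual_code n kloos_code" "y \<noteq> 0\<^sub>v n"
  obtains A where "melas_set A" "A \<noteq> {}" "card A = card (support y)"
proof -
  have y: "y \<in> carrier_vec n" "syn \<theta> y = 0" "syn (inverse \<theta>) y = 0"
    using assms by (auto simp: dual_kloos_code)
  have inj: "inj_on (\<lambda>i. \<theta> ^ i) (support y)"
    by (rule inj_on_subset[OF inj_theta support_subset[OF y(1)]])
  let ?A = "(\<lambda>i. \<theta> ^ i) ` support y"
  have "melas_set ?A"
    using y theta_nz unfolding melas_set_def sum.reindex[OF inj] by (auto simp: support_syn[OF y(1)] o_def)
  moreover have "?A \<noteq> {}" using assms(2) support_empty_iff[OF y(1)] by simp
  moreover have "card ?A = card (support y)" by (rule card_image[OF inj])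
  ultimately show ?thesis by (rule that)
qed

lemma word_of_melas_set:
  assumes "melas_set A" "A \<noteq> {}"
  obtains y where "y \<in> dual_code n kloos_code" "y \<noteq> 0\<^sub>v n" "card (support y) = card A"
proof -
  let ?S = "{i. i < n \<and> \<theta> ^ i \<in> A}"
  have S: "?S \<subseteq> {..<n}" by auto
  have img: "(\<lambda>i. \<theta> ^ i) ` ?S = A"
  proof (intro equalityI subsetI)
    fix a assume "a \<in> A"
    then have "a \<noteq> 0" using assms(1) by (auto simp: melas_set_def)
    then obtain i where "i < n" "a = \<theta> ^ i" by (rule theta_power_cases)
    then show "a \<in> (\<lambda>i. \<theta> ^ i) ` ?S" using \<open>a \<in> A\<close> by auto
  qed auto
  have inj: "inj_on (\<lambda>i. \<theta> ^ i) ?S" by (rule inj_on_subset[OF inj_theta S])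
  let ?y = "ind_vec n ?S"
  have sup: "support ?y = ?S" by (rule support_ind_vec[OF S])
  have "syn \<theta> ?y = (\<Sum>a\<in>A. a)" "syn (inverse \<theta>) ?y = (\<Sum>a\<in>A. inverse a)"
    unfolding support_syn[OF ind_vec_carrier] sup
    using sum.reindex[OF inj, of "\<lambda>a. a"] sum.reindex[OF inj, of inverse] by (simp_all add: img o_def)
  then have "?y \<in> dual_code n kloos_code"
    using assms(1) by (simp add: dual_kloos_code melas_set_def)
  moreover have "?y \<noteq> 0\<^sub>v n"
  proof -
    have "support ?y \<noteq> {}" unfolding sup using img assms(2) by (metis image_empty)
    then show ?thesis using support_empty_iff[OF ind_vec_carrier] by metis
  qed
  moreover have "card (support ?y) = card A" using sup card_image[OF inj] img by simp
  ultimately show ?thesis by (rule that)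
qed

lemma add_eq_0_iff_eq: "a + b = 0 \<longleftrightarrow> a = (b::'a)"
  by (metis add_eq_0_iff c2(3))

lemma melas_set_card_ge_3:
  assumes "melas_set A" "A \<noteq> {}"
  shows "card A \<ge> 3"
proof (rule ccontr)
  assume "\<not> card A \<ge> 3"
  moreover have "card A \<noteq> 0" using assms(2) by (simp add: card_gt_0_iff)
  ultimately consider "card A = 1" | "card A = 2" by linarith
  then show False
  proof cases
    case 1
    then obtain a where "A = {a}" by (auto simp: card_1_singleton_iff)
    then show False using assms(1) by (auto simp: melas_set_def)
  next
    case 2
    then obtain a b where "A = {a, b}" "a \<noteq> b" by (auto simp: card_2_iff)
    then show False using assms(1) by (auto simp: melas_set_def add_eq_0_iff_eq)
  qed
qed

text \<open>For odd \<open>m\<close> the group order \<open>n\<close> is 1 modulo 3, so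
  \<open>w = w ^ n = 1\<close>.\<close>

lemma cube_root_of_unity_trivial:
  assumes "odd m" "(w::'a) ^ 3 = 1"
  shows "w = 1"
proof -
  obtain k where k: "m = 2 * k + 1" using assms(1) by (rule oddE)
  have "(4::nat) ^ k mod 3 = 1"
    by (induction k) (simp_all add: mod_mult_right_eq[symmetric, of 4])
  then have "2 ^ m mod 3 = (2::nat)"
    unfolding k by (simp add: power_mult mod_mult_right_eq[symmetric, of 2])
  then have "n mod 3 = 1" unfolding Suc_n[symmetric] by presburger
  then have "n = 3 * (n div 3) + 1" by (metis mult_div_mod_eq)
  moreover have "w \<noteq> 0" using assms(2) by auto
  ultimately have "1 = w ^ (3 * (n div 3) + 1)" using pow_n by metis
  then show ?thesis using assms(2) by (simp add: power_add power_mult)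
qed

lemma melas_set_card_ge_5:
  assumes "melas_set A" "A \<noteq> {}" "odd m"
  shows "card A \<ge> 5"
proof (rule ccontr)
  assume "\<not> card A \<ge> 5"
  with melas_set_card_ge_3[OF assms(1,2)] consider "card A = 3" | "card A = 4" by linarith
  then show False
  proof cases
    case 1
    then obtain x y z where A: "A = {x, y, z}" "x \<noteq> y" "y \<noteq> z" "x \<noteq> z" by (auto simp: card_3_iff)
    then have nz: "x \<noteq> 0" "y \<noteq> 0" "z \<noteq> 0" and s: "x + (y + z) = 0" "inverse x + (inverse y + inverse z) = 0"
      using assms(1) by (auto simp: melas_set_def)
    have z: "z = x + y" using s(1) by (metis add_eq_0_iff_eq add.assoc)
    \<comment> \<open>The second elementary symmetric function vanishes; with
      \<open>z = x + y\<close> this makes \<open>x / y\<close> a cube root of unity.\<close>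
    have "x * y * z * (inverse x + (inverse y + inverse z)) = y * z + x * z + x * y"
      using nz by (simp add: field_simps)
    then have "y * z + x * z + x * y = 0" using s(2) by simp
    then have q: "x\<^sup>2 + x * y + y\<^sup>2 = 0" unfolding z
      by (simp add: power2_eq_square algebra_simps c2)
    have "x ^ 3 + y ^ 3 = (x + y) * (x\<^sup>2 + x * y + y\<^sup>2)"
      by (simp add: power2_eq_square power3_eq_cube algebra_simps c2)
    then have "x ^ 3 = y ^ 3" unfolding q by (simp add: add_eq_0_iff_eq)
    then have "(x / y) ^ 3 = 1" using nz by (simp add: power_divide)
    then have "x / y = 1" by (rule cube_root_of_unity_trivial[OF assms(3)])
    then show False using A nz by simp
  next
    case 2
    then obtain x B where B: "A = insert x B" "x \<notin> B" "card B = 3"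
      by (metis card_Suc_eq numeral_eq_Suc pred_numeral_simps(2) semiring_norm(26,27) BitM.simps eval_nat_numeral(3))
    then obtain y z w where "B = {y, z, w}" "y \<noteq> z" "z \<noteq> w" "y \<noteq> w" by (auto simp: card_3_iff)
    then have A: "A = {x, y, z, w}" "x \<noteq> y" "x \<noteq> z" "x \<noteq> w" "y \<noteq> z" "z \<noteq> w" "y \<noteq> w" using B by auto
    then have nz: "x \<noteq> 0" "y \<noteq> 0" "z \<noteq> 0" "w \<noteq> 0"
      and s: "x + (y + (z + w)) = 0" "inverse x + (inverse y + (inverse z + inverse w)) = 0"
      using assms(1) by (auto simp: melas_set_def)
    have xy: "x + y = z + w" using s(1) by (metis add_eq_0_iff_eq add.assoc)
    have "inverse x + inverse y = inverse z + inverse w" using s(2) by (metis add_eq_0_iff_eq add.assoc)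
    then have "(x + y) * (z * w) = (z + w) * (x * y)" using nz by (simp add: field_simps)
    moreover have "x + y \<noteq> 0" using A by (simp add: add_eq_0_iff_eq)
    ultimately have "x * y = z * w" using xy by simp
    \<comment> \<open>The pairs \<open>x, y\<close> and \<open>z, w\<close> have the same sum and
      product, so \<open>x\<close> is a root of the quadratic with roots \<open>z\<close> and
      \<open>w\<close>.\<close>
    then have "(x + z) * (x + w) = 0"
    proof -
      have "(x + z) * (x + w) = x * (x + (z + w)) + z * w" by (simp add: algebra_simps)
      also have "\<dots> = x * y + z * w" unfolding xy[symmetric] by (simp add: c2)
      finally show ?thesis using \<open>x * y = z * w\<close> by (simp add: c2)
    qed
    then show False using A by (simp add: add_eq_0_iff_eq)
  qed
qed

lemma melas_set_3:
  assumes "even m"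
  shows "\<exists>A. melas_set A \<and> card A = 3"
proof -
  obtain k where k: "m = 2 * k" using assms by (rule evenE)
  have "(4::nat) ^ k mod 3 = 1"
    by (induction k) (simp_all add: mod_mult_right_eq[symmetric, of 4])
  then have "Suc n mod 3 = 1" unfolding Suc_n k by (simp add: power_mult)
  then have "3 dvd n" by presburger
  then obtain l where l: "n = 3 * l" by (rule dvdE)
  \<comment> \<open>A primitive cube root of unity, available because 3 divides
    \<open>n\<close>.\<close>
  define w where "w = \<theta> ^ l"
  have "0 < l" "l < n" using l n_pos by auto
  then have "w \<noteq> 1" using order_theta unfolding w_def has_mult_order_def by auto
  have w3: "w ^ 3 = 1" using theta_pow_n unfolding w_def l by (simp add: mult.commute flip: power_mult)
  then have "w \<noteq> 0" by auto
  have "(w + 1) * (1 + (w + w\<^sup>2)) = w ^ 3 + 1"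
    by (simp add: power2_eq_square power3_eq_cube algebra_simps c2)
  then have sum0: "1 + (w + w\<^sup>2) = 0"
    using w3 \<open>w \<noteq> 1\<close> by (simp add: c2 add_eq_0_iff_eq)
  have "inverse w = w\<^sup>2" "inverse (w\<^sup>2) = w"
    using w3 by (intro inverse_unique; simp add: power2_eq_square power3_eq_cube mult.assoc)+
  moreover have "w\<^sup>2 \<noteq> 1" using w3 \<open>w \<noteq> 1\<close> by (auto simp: power3_eq_cube power2_eq_square)
  moreover have "w \<noteq> w\<^sup>2" using \<open>w \<noteq> 1\<close> \<open>w \<noteq> 0\<close> by (auto simp: power2_eq_square)
  ultimately have "melas_set {1, w, w\<^sup>2}" "card {1, w, w\<^sup>2} = 3"
    using \<open>w \<noteq> 1\<close> \<open>w \<noteq> 0\<close> sum0 unfolding melas_set_def by (auto simp: add_ac)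
  then show ?thesis by blast
qed

text \<open>Translation by \<open>y / a\<close> with \<open>tr y = 1\<close> interchanges the two
  trace values.\<close>

lemma card_tr: 
  assumes "a \<noteq> 0"
  shows "2 * card {x. tr (a * x) = 1} = 2 ^ m"
proof -
  obtain y where y: "tr y = 1" using tr_onto by blast
  have ay: "tr (a * (x + y / a)) = tr (a * x) + 1" for x
    using assms y by (simp add: distrib_left tr_add)
  have "bij_betw (\<lambda>x. x + y / a) {x. tr (a * x) = 1} {x. tr (a * x) = 0}"
  proof (rule bij_betw_byWitness[where f' = "\<lambda>x. x + y / a"])
    show "(\<lambda>x. x + y / a) ` {x. tr (a * x) = 1} \<subseteq> {x. tr (a * x) = 0}" using ay by (auto simp: c2)
    show "(\<lambda>x. x + y / a) ` {x. tr (a * x) = 0} \<subseteq> {x. tr (a * x) = 1}" using ay by auto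
  qed (auto simp: c2 add.assoc)
  then have "card {x. tr (a * x) = 1} = card {x. tr (a * x) = 0}" by (rule bij_betw_same_card)
  moreover have "card {x. tr (a * x) = 1} + card {x. tr (a * x) = 0} = CARD('a)"
    using tr_01 by (subst card_Un_disjoint[symmetric]) (auto intro!: arg_cong[where f = card])
  ultimately show ?thesis using card_UNIV by simp
qed

text \<open>The half trace \<open>r\<close>, the sum of \<open>z^(4^i)\<close> for
  \<open>i \<le> (m - 1) / 2\<close>, is a solution: its square supplies the odd iterates of
  squaring, so \<open>r^2 + r = tr z + z^(2^m)\<close>.\<close>

lemma hilbert_90_odd:
  assumes "odd m" "tr z = 0"
  shows "\<exists>r. r\<^sup>2 + r = z"
proof -
  obtain k where k: "m = 2 * k + 1" using assms(1) by (rule oddE)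
  define r where "r = (\<Sum>i<Suc k. z ^ 2 ^ (2 * i))"
  have split: "(\<Sum>i<j. z ^ 2 ^ (2 * i + 1)) + (\<Sum>i<j. z ^ 2 ^ (2 * i)) = (\<Sum>i<2 * j. z ^ 2 ^ i)" for j
    by (induction j) (simp_all add: add_ac)
  have "r\<^sup>2 + r = (\<Sum>i<2 * Suc k. z ^ 2 ^ i)"
    unfolding r_def char2_square_sum[OF char2] split[symmetric]
    by (simp add: mult.commute flip: power_mult)
  also have "2 * Suc k = Suc m" using k by simp
  also have "(\<Sum>i<Suc m. z ^ 2 ^ i) = tr z + z" by (simp add: tr_def pow_q)
  finally show ?thesis using assms(2) by auto
qed

text \<open>
  Inversion shows that half of the \<open>x\<close> with \<open>tr x \<noteq> tr (1/x)\<close> have \<open>tr x = 1\<close>, so the number of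
  \<open>w \<noteq> 0\<close> with \<open>tr w = tr (1/w) = 1\<close> is \<open>(2 ^ m - kloos 1) / 2\<close>.
\<close>
lemma exists_tr_1_1:
  assumes "m \<ge> 5"
  shows "\<exists>w. w \<noteq> 0 \<and> w \<noteq> 1 \<and> tr w = 1 \<and> tr (1 / w) = 1"
proof (rule ccontr)
  assume none: "\<not> ?thesis"
  define P where "P = {x. tr x = 1}"
  define N where "N = {x. x \<noteq> 0 \<and> tr (x + 1 / x) = 1}"
  have zN: "card N = kloos 1" by (simp add: N_def kloos_def)
  have cP: "2 * card P = 2 ^ m" using card_tr[of 1] by (simp add: P_def)
  have tr_ne: "tr (1 / x) = 0 \<longleftrightarrow> tr x = 1" if "x \<in> N" for x
    using that tr_01[of x] tr_01[of "1 / x"] by (auto simp: N_def tr_add c2)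
  have inv_N: "1 / x \<in> N" if "x \<in> N" for x
    using that by (simp add: N_def add.commute)
  have inv_P: "1 / x \<in> P \<longleftrightarrow> x \<notin> P" if "x \<in> N" for x
    using tr_ne[OF that] tr_01[of "1 / x"] by (auto simp: P_def)
  have "bij_betw (\<lambda>x. 1 / x) (N \<inter> P) (N - P)"
    by (rule bij_betw_byWitness[where f' = "\<lambda>x. 1 / x"]) (use inv_N inv_P in auto)
  then have "card (N \<inter> P) = card (N - P)" by (rule bij_betw_same_card)
  moreover have "card (N \<inter> P) + card (N - P) = card N"
    by (subst card_Un_disjoint[symmetric]) (auto intro!: arg_cong[where f = card])
  ultimately have half_N: "2 * card (N \<inter> P) = kloos 1" using zN by simp
  have "P - N \<subseteq> {1}"
  proof
    fix x assume x: "x \<in> P - N"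
    then have "tr x = 1" "x \<noteq> 0" by (auto simp: P_def)
    moreover have "tr (1 / x) = 1"
      using x tr_01[of "1 / x"] by (auto simp: P_def N_def tr_add)
    ultimately show "x \<in> {1}" using none by blast
  qed
  then have "card (P - N) \<le> 1" using card_mono[of "{1}" "P - N"] by simp
  moreover have "card (P - N) + card (N \<inter> P) = card P"
    by (subst card_Un_disjoint[symmetric]) (auto intro!: arg_cong[where f = card])
  \<comment> \<open>Then \<open>2 * kloos 1 - n\<close> is at least \<open>2 ^ m - 3\<close>, which
    is too large for the Kloosterman bound.\<close>
  ultimately have "2 ^ m \<le> kloos 1 + 2" using half_N cP by linarith
  then have "int (2 ^ m) \<le> int (kloos 1) + 2" by linarith
  moreover have "int n + 1 = int (2 ^ m)" using Suc_n by linarith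
  ultimately have L: "2 * int (kloos 1) - int n \<ge> 2 ^ m - 3" by simp
  have q: "(2::int) ^ m \<ge> 32" using power_increasing[of 5 m "2::int"] assms by simp
  have "(2 * int (kloos 1) - int n)\<^sup>2 \<le> 4 * 2 ^ m"
    using L q by (intro kloosterman_bound) auto
  moreover have "(2 * int (kloos 1) - int n)\<^sup>2 \<ge> (2 ^ m - 3)\<^sup>2"
    using L q by (intro power_mono) auto
  moreover have "((2::int) ^ m - 3)\<^sup>2 > 4 * 2 ^ m"
  proof -
    have "(2::int) ^ m * 2 ^ m \<ge> 32 * 2 ^ m" using q by (intro mult_right_mono) auto
    moreover have "((2::int) ^ m - 3)\<^sup>2 = 2 ^ m * 2 ^ m - 6 * 2 ^ m + 9"
      by (simp add: power2_eq_square algebra_simps)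
    ultimately show ?thesis using q by linarith
  qed
  ultimately show False by linarith
qed

text \<open>The substitution \<open>x = r * s\<close> turns \<open>x^2 + s x + 1 = 0\<close> into
  the Artin-Schreier equation \<open>r^2 + r = 1/s^2\<close>, whose right-hand side has the same
  trace as \<open>1/s\<close>.\<close>

lemma sum_with_inverse:
  assumes "odd m" "s \<noteq> 0" "tr (1 / s) = 0"
  shows "\<exists>x. x \<noteq> 0 \<and> x + 1 / x = s"
proof -
  have "tr ((1 / s)\<^sup>2) = 0" using assms(3) tr_square by simp
  then obtain r where r: "r\<^sup>2 + r = (1 / s)\<^sup>2" using hilbert_90_odd[OF assms(1)] by blast
  have "(r * s) * (r * s) + (r * s) * s = (r\<^sup>2 + r) * s\<^sup>2"
    by (simp add: power2_eq_square algebra_simps)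
  also have "\<dots> = 1" unfolding r using assms(2) by (simp add: power_divide)
  finally have 1: "(r * s) * (r * s + s) = 1" by (simp add: distrib_left)
  then have "r * s \<noteq> 0" by auto
  moreover have "1 / (r * s) = r * s + s" using inverse_unique[OF 1] by (simp only: inverse_eq_divide)
  ultimately show ?thesis by (intro exI[of _ "r * s"]) (simp add: c2)
qed

text \<open>The word of weight 5 found here has locators \<open>1, x, 1/x, z, 1/z\<close> with \<open>x + 1/x = s\<close> and \<open>z + 1/z = s + 1\<close>.\<close>
lemma melas_set_5:
  assumes "odd m"
  shows "\<exists>A. melas_set A \<and> card A = 5"
proof -
  have "m \<noteq> 4" using assms by auto
  then have "m \<ge> 5" using m_ge by linarith
  then obtain w where w: "w \<noteq> 0" "w \<noteq> 1" "tr w = 1" "tr (1 / w) = 1" using exists_tr_1_1 by blast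
  have tr1: "tr 1 = 1"
  proof -
    obtain k where "m = 2 * k + 1" using assms by (rule oddE)
    then have "of_nat m = (1::'a)" by (simp add: char2)
    then show ?thesis by (simp add: tr_def)
  qed
  \<comment> \<open>Chosen so that \<open>1/s = 1 + w\<close> and
    \<open>1/(s + 1) = 1 + 1/w\<close>; both have trace 0, since \<open>tr 1 = 1\<close> for odd
    \<open>m\<close>.\<close>
  define s where "s = 1 / (1 + w)"
  have w1: "1 + w \<noteq> 0" using w by (simp add: add_eq_0_iff_eq)
  have s: "s \<noteq> 0" "tr (1 / s) = 0" using w1 w(3) by (simp_all add: s_def tr_add tr1 c2)
  have s1: "s + 1 = w / (1 + w)" using w1 by (simp add: s_def field_simps c2)
  then have "s + 1 \<noteq> 0" using w w1 by simp
  have "1 / (s + 1) = 1 + 1 / w" unfolding s1 using w(1) w1 by (simp add: field_simps)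
  then have "tr (1 / (s + 1)) = 0" using w(4) by (simp add: tr_add tr1 c2)
  then obtain x z where x: "x \<noteq> 0" "x + 1 / x = s" and z: "z \<noteq> 0" "z + 1 / z = s + 1"
    using sum_with_inverse[OF assms] s \<open>s + 1 \<noteq> 0\<close> by metis
  have self: "a = b \<Longrightarrow> a + b = 0" for a b :: 'a by (simp add: c2)
  have ne: "x \<noteq> 1 / x" "z \<noteq> 1 / z" using x(2) z(2) s(1) \<open>s + 1 \<noteq> 0\<close> self by metis+
  have ne1: "x \<noteq> 1" "z \<noteq> 1" using x(2) z(2) s(1) \<open>s + 1 \<noteq> 0\<close> char2 by auto
  have "s \<noteq> s + 1" by simp
  then have ne2: "x \<noteq> z" using x(2) z(2) by auto
  have ne3: "x \<noteq> 1 / z"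
  proof
    assume "x = 1 / z"
    then have "x + 1 / x = z + 1 / z" by (simp add: add.commute)
    then show False using x(2) z(2) by simp
  qed
  have "1 / x \<noteq> 1" "1 / z \<noteq> 1" "1 / x \<noteq> z" "1 / x \<noteq> 1 / z"
    using ne1 ne2 ne3 x(1) z(1) by auto
  note ne ne1 ne2 ne3 this
  then have "card {1, x, 1 / x, z, 1 / z} = 5"
    and sums: "\<And>f. (\<Sum>a\<in>{1, x, 1 / x, z, 1 / z}. f a) = f 1 + (f x + (f (1 / x) + (f z + f (1 / z)))) "
    by (simp_all add: eq_commute[of 1])
  moreover have "1 + (x + (1 / x + (z + 1 / z))) = 0"
  proof -
    have "1 + (x + (1 / x + (z + 1 / z))) = 1 + ((x + 1 / x) + (z + 1 / z))" by (simp only: add.assoc)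
    then show ?thesis unfolding x z by (simp add: c2 add_ac)
  qed
  \<comment> \<open>The set is closed under inversion, so the sum of inverses is the same sum
    reordered.\<close>
  moreover from this have "1 + (1 / x + (x + (1 / z + z))) = 0" by (simp only: add_ac)
  ultimately have "melas_set {1, x, 1 / x, z, 1 / z}"
    unfolding melas_set_def sums using x(1) z(1) by (simp add: inverse_eq_divide)
  with \<open>card {1, x, 1 / x, z, 1 / z} = 5\<close> show ?thesis by blast
qed

lemma min_distance_melas: "min_distance (dual_code n kloos_code) = (if even m then 3 else 5)" (is "_ = ?d")
  and melas_weight_ge: "y \<in> dual_code n kloos_code \<Longrightarrow> y \<noteq> 0\<^sub>v n \<Longrightarrow> card (support y) \<ge> (if even m then 3 else 5)"
proof -
  show ge: "card (support y) \<ge> ?d" if y: "y \<in> dual_code n kloos_code" "y \<noteq> 0\<^sub>v n" for y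
  proof -
    obtain A where "melas_set A" "A \<noteq> {}" "card A = card (support y)"
      using melas_set_of_word[OF y] .
    then show ?thesis using melas_set_card_ge_3[of A] melas_set_card_ge_5[of A] by simp
  qed
  interpret dual: binary_linear_code n "dual_code n kloos_code" by (rule kloos.dual_linear)
  obtain A where A: "melas_set A" "card A = ?d" using melas_set_3 melas_set_5 by (cases "even m") auto
  then have "A \<noteq> {}" by (auto split: if_splits)
  with A obtain y where "y \<in> dual_code n kloos_code" "y \<noteq> 0\<^sub>v n" "card (support y) = ?d"
    by (metis word_of_melas_set)
  then show "min_distance (dual_code n kloos_code) = ?d" using ge by (intro dual.min_distance_eq)
qed

section \<open>Weights of the trace words and the covering radius\<close>

lemma card_support_cw: "card (support (cw a b)) = card {x. x \<noteq> 0 \<and> tr (a * x + b / x) = 1}"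
proof -
  have "(\<lambda>i. \<theta> ^ i) ` support (cw a b) = {x. x \<noteq> 0 \<and> tr (a * x + b / x) = 1}"
  proof (intro equalityI subsetI)
    fix x assume "x \<in> {x. x \<noteq> 0 \<and> tr (a * x + b / x) = 1}"
    then have x: "x \<noteq> 0" "tr (a * x + b / x) = 1" by auto
    from x(1) obtain i where "i < n" "x = \<theta> ^ i" by (rule theta_power_cases)
    then show "x \<in> (\<lambda>i. \<theta> ^ i) ` support (cw a b)"
      using x by (auto simp: support_def cw_def bitr_eq_1 power_inverse divide_inverse)
  qed (auto simp: support_def cw_def bitr_eq_1 power_inverse divide_inverse theta_nz)
  moreover have "inj_on (\<lambda>i. \<theta> ^ i) (support (cw a b))"
    by (rule inj_on_subset[OF inj_theta support_subset[OF cw_carrier]])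
  ultimately show ?thesis by (metis card_image)
qed

lemma card_inverse_image: "card {x::'a. x \<noteq> 0 \<and> Q (1 / x)} = card {x. x \<noteq> 0 \<and> Q x}"
  by (rule bij_betw_same_card[of "\<lambda>x. 1 / x"], rule bij_betw_byWitness[where f' = "\<lambda>x. 1 / x"]) auto

lemma card_scale_image:
  assumes "c \<noteq> 0"
  shows "card {x::'a. x \<noteq> 0 \<and> Q (c * x)} = card {x. x \<noteq> 0 \<and> Q x}"
  by (rule bij_betw_same_card[of "\<lambda>x. c * x"], rule bij_betw_byWitness[where f' = "\<lambda>x. x / c"])
     (use assms in auto)

text \<open>If exactly one of \<open>a\<close>, \<open>b\<close> is 0, the word has weight
  \<open>2 ^ (m - 1)\<close> and \<open>L = 1\<close>; for the zero word \<open>L = - n\<close>.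
  Otherwise scaling \<open>x\<close> by \<open>a\<close> turns the weight into
  \<open>kloos (a * b)\<close>.\<close>

lemma weight_bound:
  fixes a b :: 'a
  defines "L \<equiv> 2 * int (card (support (cw a b))) - int n"
  shows "L \<le> 1 \<or> L\<^sup>2 \<le> 4 * 2 ^ m"
proof -
  have lin: "2 * card {x. x \<noteq> 0 \<and> tr (c * x) = 1} = 2 ^ m" if "c \<noteq> 0" for c
  proof -
    have "{x. x \<noteq> 0 \<and> tr (c * x) = 1} = {x. tr (c * x) = 1}" by auto
    then show ?thesis using card_tr[OF that] by simp
  qed
  consider "a = 0" "b = 0" | "a \<noteq> 0" "b = 0" | "a = 0" "b \<noteq> 0" | "a \<noteq> 0" "b \<noteq> 0" by blast
  then show ?thesis
  proof cases
    case 1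
    then have "L = - int n" unfolding L_def card_support_cw by simp
    then show ?thesis by simp
  next
    case 2
    then show ?thesis using lin[of a] Suc_n unfolding L_def card_support_cw by simp
  next
    case 3
    have "card (support (cw a b)) = card {x. x \<noteq> 0 \<and> tr (b * x) = 1}"
      using card_inverse_image[of "\<lambda>x. tr (b * x) = 1"] 3 by (simp add: card_support_cw)
    then show ?thesis using lin[OF 3(2)] Suc_n unfolding L_def by linarith
  next
    case 4
    have "a * x + b / x = a * x + (a * b) / (a * x)" for x using 4 by simp
    then have "card (support (cw a b)) = kloos (a * b)"
      using card_scale_image[OF 4(1), of "\<lambda>y. tr (y + (a * b) / y) = 1"]
      by (simp add: card_support_cw kloos_def)
    then show ?thesis using kloosterman_bound[of "a * b"] 4 unfolding L_def by fastforce
  qed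
qed

text \<open>The all-one vector has distance \<open>(n - L) / 2\<close> from a word, with
  \<open>L\<close> as in \<open>weight_bound\<close>, so an upper bound on \<open>L\<close> for all
  words suffices.\<close>

lemma covering_radius_kloos:
  "\<lceil>(2 ^ m - 1 - real_of_int \<lfloor>2 powr (real m / 2 + 1)\<rfloor>) / 2\<rceil> \<le> int (covering_radius n kloos_code)"
proof -
  let ?fl = "\<lfloor>2 powr (real m / 2 + 1)\<rfloor>"
  let ?ones = "ind_vec n {..<n}"
  let ?d = "\<lceil>(2 ^ m - 1 - real_of_int ?fl) / 2\<rceil>"
  have pw: "(2 powr (real m / 2 + 1))\<^sup>2 = 4 * 2 ^ m"
  proof -
    have "(2 powr (real m / 2 + 1))\<^sup>2 = 2 powr (real m + 2)"
      by (simp add: power2_eq_square flip: powr_add)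
    then show ?thesis by (simp add: powr_add powr_realpow)
  qed
  have "nat ?d \<le> hamming_dist x ?ones" if x: "x \<in> kloos_code" for x
  proof -
    obtain a b where ab: "x = cw a b" using x by (auto simp: kloos_code_def)
    define L where "L = 2 * int (card (support x)) - int n"
    \<comment> \<open>Since \<open>L\<close> is an integer, its real upper bound may be rounded
      down.\<close>
    have "L \<le> ?fl"
    proof -
      have "real_of_int L \<le> 2 powr (real m / 2 + 1)"
      proof (cases "L \<le> 1")
        case True
        have "(1::real) \<le> 2 powr (real m / 2 + 1)" by (intro ge_one_powr_ge_zero) auto
        then show ?thesis using True by linarith
      next
        case False
        then have "L\<^sup>2 \<le> 4 * 2 ^ m" using weight_bound[of a b] by (simp add: L_def ab)
        then have "real_of_int (L\<^sup>2) \<le> real_of_int (4 * 2 ^ m)" by (simp only: of_int_le_iff)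
        then have "(real_of_int L)\<^sup>2 \<le> (2 powr (real m / 2 + 1))\<^sup>2" unfolding pw by simp
        then show ?thesis by (rule power2_le_imp_le) simp
      qed
      then show ?thesis by (simp add: le_floor_iff)
    qed
    have c: "x \<in> carrier_vec n" by (simp add: ab)
    have "support (x + ?ones) = {..<n} - support x"
    proof -
      have "t + 1 = 1 \<longleftrightarrow> t \<noteq> 1" for t :: bit by (cases t) (simp_all add: add_bit_eq_xor)
      then show ?thesis using c by (auto simp: support_def ind_vec_def)
    qed
    then have "hamming_dist x ?ones = n - card (support x)"
      using c support_subset[OF c] by (simp add: hamming_dist_support[of _ n] card_Diff_subset)
    moreover have "card (support x) \<le> n" using card_mono[OF _ support_subset[OF c]] by simp
    ultimately have "2 * int (hamming_dist x ?ones) = int n - L" unfolding L_def by simp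
    then have "2 * real (hamming_dist x ?ones) = real n - real_of_int L" by linarith
    moreover have "real n = 2 ^ m - 1" using arg_cong[OF Suc_n, of real] by simp
    ultimately have "(2 ^ m - 1 - real_of_int ?fl) / 2 \<le> real_of_int (int (hamming_dist x ?ones))"
      using \<open>L \<le> ?fl\<close> by simp
    then have "?d \<le> int (hamming_dist x ?ones)" by (rule ceiling_le)
    then show ?thesis by (simp only: nat_le_iff)
  qed
  then have "nat ?d \<le> covering_radius n kloos_code"
    using kloos.carrier kloos.zero by (intro covering_radius_ge[of _ _ ?ones]) auto
  then show ?thesis by linarith
qed

end

theorem theorem6p6:
  fixes m n \<tau> :: nat
    and \<theta> :: "'a::{field,finite}"
    and g\<^sub>1 g\<^sub>m\<^sub>1 g :: "bit poly"
    and C OA :: "bit vec set"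
  assumes "m \<ge> 4"
    and "n = 2 ^ m - 1"
    and "CARD('a) = 2 ^ m"
    and "has_mult_order \<theta> (2 ^ m - 1)"
    and "is_min_poly \<theta> g\<^sub>1"
    and "is_min_poly (inverse \<theta>) g\<^sub>m\<^sub>1"
    and "g = g\<^sub>1 * g\<^sub>m\<^sub>1"
    and "C = cyclic_code n g"
    and "OA = dual_code n C"
    and "\<tau> = (if even m then 2 else 4)"
  shows "card OA = 2 ^ (2 * m)
    \<and> orthogonal_array n OA \<tau>
    \<and> \<tau> = min_distance (dual_code n OA) - 1
    \<and> int (covering_radius n OA)
        \<ge> \<lceil>(2 ^ m - 1 - real_of_int \<lfloor>2 powr (real m / 2 + 1)\<rfloor>) / 2\<rceil>"
proof -
  interpret binary_field m n \<theta>
    using assms(1-4) by unfold_locales auto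
  have C: "C = dual_code n kloos_code"
    using cyclic_code_eq[OF assms(5,6)] assms(7,8) by simp
  then have OA: "OA = kloos_code" using assms(9) kloos.double_dual by simp
  have "orthogonal_array n kloos_code \<tau>"
  proof (rule kloos.orthogonal_array_if_dual_distance)
    show "\<tau> \<le> n" using n_pos assms(10) by simp
    show "card (support x) > \<tau>" if "x \<in> dual_code n kloos_code" "x \<noteq> 0\<^sub>v n" for x
      using melas_weight_ge[OF that] assms(10) by (simp split: if_splits)
  qed
  then show ?thesis
    using card_kloos_code min_distance_melas covering_radius_kloos assms(10) unfolding OA by simp
qed

end
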